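(* Let $\Delta\ge 3$ be an integer. (i) There is a sequence of instances $(\mathcal{T}_n,w_n)$, with $\mathcal{T}_n$ a finite tree of maximum degree at most $\Delta$ and $w_n:V(\mathcal{T}_n)\to\mathbb{R}_{\ge0}$, such that for every choice of centroid trees $C_n$ of $(\mathcal{T}_n,w_n)$, $$\lim_{n\to\infty}\frac{\mathtt{cost}_{w_n}(C_n)}{\mathtt{OPT}(\mathcal{T}_n,w_n)}=2-\frac{1}{2^\Delta}.$$ (ii) There is a sequence of instances $(\mathcal{T}_n,w_n)$ with $\mathcal{T}_n$ of maximum degree at most $\Delta$, $w_n(\mathcal{T}_n)=1$, and $\lim_{n\to\infty}\mathtt{OPT}(\mathcal{T}_n,w_n)=\infty$, such that every centroid tree $C_n$ of $(\mathcal{T}_n,w_n)$ satisfies $$\mathtt{cost}_{w_n}(C_n)\ge\left(2-\frac{4}{2^\Delta}\right)\mathtt{OPT}(\mathcal{T}_n,w_n)-1.$$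
   Context: For a subgraph $\mathcal{H}$ of $\mathcal{T}$, $w(\mathcal{H})=\sum_{x\in V(\mathcal{H})}w(x)$. A search tree on a tree $\mathcal{T}$ is a rooted tree $T$ with vertex set $V(\mathcal{T})$ defined recursively: its root is an arbitrary vertex $r$, and the children of $r$ are the roots of search trees built on the connected components of $\mathcal{T}-r$; a single-vertex tree has only itself as search tree. $\mathtt{cost}_w(T)=\sum_x w(x)\,\mathtt{depth}_T(x)$ with root depth $1$; $\mathtt{OPT}(\mathcal{T},w)$ is the minimum cost over all search trees on $\mathcal{T}$. A vertex $v$ is a centroid of $(\mathcal{T},w)$ if each component $\mathcal{H}$ of $\mathcal{T}-v$ has $w(\mathcal{H})\le w(\mathcal{T})/2$. A search tree $T$ is a centroid tree if each vertex $x$ is a centroid of $(\mathcal{T}[V(T_x)],w)$, $T_x$ being the subtree of $T$ rooted at $x$. *)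

theory Defs
  imports Complex_Main
begin

definition reach :: "('a \<Rightarrow> 'a \<Rightarrow> bool) \<Rightarrow> 'a set \<Rightarrow> 'a \<Rightarrow> 'a \<Rightarrow> bool" where
  "reach E S x y \<longleftrightarrow> (x, y) \<in> {(a, b). a \<in> S \<and> b \<in> S \<and> E a b}\<^sup>*"

definition comps :: "('a \<Rightarrow> 'a \<Rightarrow> bool) \<Rightarrow> 'a set \<Rightarrow> 'a set set" where
  "comps E S = {{y \<in> S. reach E S x y} | x. x \<in> S}"

text \<open>A finite tree: nonempty, finite, symmetric irreflexive edges inside V,
  connected, and with exactly |V| - 1 edges (each counted twice as ordered pairs).\<close>
definition is_tree :: "'a set \<Rightarrow> ('a \<Rightarrow> 'a \<Rightarrow> bool) \<Rightarrow> bool" where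
  "is_tree V E \<longleftrightarrow> finite V \<and> V \<noteq> {}
     \<and> (\<forall>x y. E x y \<longrightarrow> x \<in> V \<and> y \<in> V \<and> E y x \<and> x \<noteq> y)
     \<and> (\<forall>x\<in>V. \<forall>y\<in>V. reach E V x y)
     \<and> card {(x, y). x \<in> V \<and> y \<in> V \<and> E x y} = 2 * (card V - 1)"

definition max_deg_le :: "'a set \<Rightarrow> ('a \<Rightarrow> 'a \<Rightarrow> bool) \<Rightarrow> nat \<Rightarrow> bool" where
  "max_deg_le V E D \<longleftrightarrow> (\<forall>v\<in>V. card {u \<in> V. E v u} \<le> D)"

datatype 'a stree = Node 'a "'a stree list"

fun verts :: "'a stree \<Rightarrow> 'a set" where
  "verts (Node r ts) = insert r (\<Union>t\<in>set ts. verts t)"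

fun subtrees :: "'a stree \<Rightarrow> 'a stree set" where
  "subtrees (Node r ts) = insert (Node r ts) (\<Union>t\<in>set ts. subtrees t)"

fun root :: "'a stree \<Rightarrow> 'a" where
  "root (Node r ts) = r"

fun search_tree :: "('a \<Rightarrow> 'a \<Rightarrow> bool) \<Rightarrow> 'a set \<Rightarrow> 'a stree \<Rightarrow> bool" where
  "search_tree E S (Node r ts) \<longleftrightarrow>
     r \<in> S \<and> distinct (map verts ts) \<and> set (map verts ts) = comps E (S - {r})
     \<and> (\<forall>t\<in>set ts. search_tree E (verts t) t)"

fun cost_d :: "('a \<Rightarrow> real) \<Rightarrow> nat \<Rightarrow> 'a stree \<Rightarrow> real" where
  "cost_d w d (Node r ts) = real d * w r + sum_list (map (cost_d w (Suc d)) ts)"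

definition cost :: "('a \<Rightarrow> real) \<Rightarrow> 'a stree \<Rightarrow> real" where
  "cost w T = cost_d w 1 T"

definition OPT :: "'a set \<Rightarrow> ('a \<Rightarrow> 'a \<Rightarrow> bool) \<Rightarrow> ('a \<Rightarrow> real) \<Rightarrow> real" where
  "OPT V E w = Inf {cost w T | T. search_tree E V T}"

definition is_centroid :: "('a \<Rightarrow> 'a \<Rightarrow> bool) \<Rightarrow> ('a \<Rightarrow> real) \<Rightarrow> 'a set \<Rightarrow> 'a \<Rightarrow> bool" where
  "is_centroid E w S v \<longleftrightarrow> v \<in> S \<and> (\<forall>H\<in>comps E (S - {v}). sum w H \<le> sum w S / 2)"

definition centroid_tree :: "'a set \<Rightarrow> ('a \<Rightarrow> 'a \<Rightarrow> bool) \<Rightarrow> ('a \<Rightarrow> real) \<Rightarrow> 'a stree \<Rightarrow> bool" where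
  "centroid_tree V E w T \<longleftrightarrow> search_tree E V T
     \<and> (\<forall>X\<in>subtrees T. is_centroid E w (verts X) (root X))"

end

theory Submission
  imports Defs
begin

text \<open>
  Join weighted trees \<open>A\<close>, \<open>B\<close> of equal weight by a new vertex \<open>u\<close> of tiny positive weight, adjacent
  to one vertex of each. Then \<open>u\<close> is the only centroid, so centroid trees pay the total weight \<open>W\<close>
  plus their costs on \<open>A\<close> and \<open>B\<close>. Conversely, whichever vertex is the root of a search tree, it lies
  above the whole of \<open>A\<close> or the whole of \<open>B\<close>, so every search tree pays at least the weight of \<open>A\<close>,
  about \<open>W / 2\<close>, plus the optima on \<open>A\<close> and \<open>B\<close>.

  Start with a centre \<open>v\<close> and successively join to it, always at \<open>v\<close>, copies \<open>H\<^sub>1, H\<^sub>2, \<dots>\<close> of the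
  previous tree, each as heavy as what is already there. Centroid trees peel the copies off one at a
  time, whereas rooting at \<open>v\<close> separates all of them at once (the connecting vertices can be hung
  below the leaves of the copies almost for free). For (i) the centre is a single vertex of relative
  weight \<open>1 / 2 ^ \<Delta>\<close>; iterating the construction, the centroid cost tends to \<open>2 * 2 ^ \<Delta> - 1\<close> and the
  optimum to \<open>2 ^ \<Delta>\<close>. For (ii) the centre joins two copies and is followed by \<open>\<Delta> - 2\<close> more, so each
  round adds \<open>2 - 4 / 2 ^ \<Delta>\<close> to the centroid cost and at most \<open>1\<close> to the optimum, up to errors that
  vanish with the weights of the connecting vertices.
\<close>

subsection \<open>Connected components\<close>

definition conn :: "('a \<Rightarrow> 'a \<Rightarrow> bool) \<Rightarrow> 'a set \<Rightarrow> bool" where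
  "conn E S \<longleftrightarrow> (\<forall>x\<in>S. \<forall>y\<in>S. reach E S x y)"

lemma reach_refl [simp]: "reach E S x x"
  by (simp add: reach_def)

lemma reach_step: "x \<in> S \<Longrightarrow> y \<in> S \<Longrightarrow> E x y \<Longrightarrow> reach E S x y"
  by (auto simp: reach_def)

lemma reach_trans: "reach E S x y \<Longrightarrow> reach E S y z \<Longrightarrow> reach E S x z"
  by (auto simp: reach_def)

lemma reach_mono:
  assumes "reach E S x y" "S \<subseteq> T"
  shows "reach E T x y"
proof -
  have "{(a, b). a \<in> S \<and> b \<in> S \<and> E a b} \<subseteq> {(a, b). a \<in> T \<and> b \<in> T \<and> E a b}"
    using assms(2) by auto
  then show ?thesis
    using assms(1) rtrancl_mono unfolding reach_def by blast
qed

lemma reach_sym: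
  assumes "reach E S x y" and "\<And>x y. x \<in> S \<Longrightarrow> y \<in> S \<Longrightarrow> E x y \<Longrightarrow> E y x"
  shows "reach E S y x"
proof -
  have "sym {(a, b). a \<in> S \<and> b \<in> S \<and> E a b}"
    using assms(2) by (auto simp: sym_def)
  then show ?thesis
    using assms(1) unfolding reach_def by (blast dest: symD[OF sym_rtrancl])
qed

text \<open>Edges of \<open>S\<close> starting in \<open>H\<close> end in \<open>H\<close>, so no
  path can leave \<open>H\<close>. Closure of outgoing edges suffices for this; the relation may be
  directed.\<close>

lemma reach_confined:
  assumes "reach E S x y" "x \<in> H" "H \<subseteq> S"
    and "\<And>x y. x \<in> H \<Longrightarrow> y \<in> S \<Longrightarrow> E x y \<Longrightarrow> y \<in> H"
  shows "y \<in> H \<and> reach E H x y"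
proof -
  have "(x, y) \<in> {(a, b). a \<in> S \<and> b \<in> S \<and> E a b}\<^sup>*"
    using assms(1) by (simp add: reach_def)
  then show ?thesis
  proof (induction rule: rtrancl_induct)
    case base
    then show ?case using assms(2) by simp
  next
    case (step y z)
    then have z: "z \<in> H" using assms(4) by auto
    have "reach E H y z" using step z by (intro reach_step) auto
    then show ?case using step z reach_trans by metis
  qed
qed

lemma reach_cong:
  assumes "\<And>x y. x \<in> S \<Longrightarrow> y \<in> S \<Longrightarrow> E x y = E' x y"
  shows "reach E S x y = reach E' S x y"
proof -
  have "{(a, b). a \<in> S \<and> b \<in> S \<and> E a b} = {(a, b). a \<in> S \<and> b \<in> S \<and> E' a b}"
    using assms by auto
  then show ?thesis by (simp add: reach_def)
qed

lemma comps_cong: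
  assumes "\<And>x y. x \<in> S \<Longrightarrow> y \<in> S \<Longrightarrow> E x y = E' x y"
  shows "comps E S = comps E' S"
  unfolding comps_def using reach_cong[of S E E', OF assms] by simp

lemma conn_cong:
  assumes "\<And>x y. x \<in> S \<Longrightarrow> y \<in> S \<Longrightarrow> E x y = E' x y"
  shows "conn E S = conn E' S"
  unfolding conn_def using reach_cong[of S E E', OF assms] by simp

lemma Union_comps: "\<Union> (comps E S) = S"
proof -
  have "x \<in> {y \<in> S. reach E S x y}" if "x \<in> S" for x using that by simp
  then show ?thesis unfolding comps_def by blast
qed

lemma comps_empty [simp]: "comps E {} = {}"
  by (simp add: comps_def)

lemma comps_conn: "conn E S \<Longrightarrow> S \<noteq> {} \<Longrightarrow> comps E S = {S}"
  unfolding comps_def conn_def by auto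

lemma conn_singleton [simp]: "conn E {x}"
  by (simp add: conn_def)

lemma conn_Un:
  assumes "conn E S" "conn E T" "s \<in> S" "t \<in> T" "E s t" "E t s"
  shows "conn E (S \<union> T)"
proof -
  have S: "reach E (S \<union> T) x y" if "x \<in> S" "y \<in> S" for x y
    using assms(1) that reach_mono[of E S x y "S \<union> T"] unfolding conn_def by blast
  have T: "reach E (S \<union> T) x y" if "x \<in> T" "y \<in> T" for x y
    using assms(2) that reach_mono[of E T x y "S \<union> T"] unfolding conn_def by blast
  have st: "reach E (S \<union> T) s t" "reach E (S \<union> T) t s"
    using assms by (auto intro: reach_step)
  have "reach E (S \<union> T) x s \<and> reach E (S \<union> T) s x" if "x \<in> S \<union> T" for x
    using that S[of x s] S[of s x] T[of x t] T[of t x] st assms(3,4)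
    by (auto intro: reach_trans)
  then show ?thesis
    unfolding conn_def by (blast intro: reach_trans)
qed

lemma conn_in_comp:
  assumes "conn E C" "C \<noteq> {}" "C \<subseteq> S"
  obtains H where "H \<in> comps E S" "C \<subseteq> H"
proof -
  obtain x where x: "x \<in> C" using assms(2) by auto
  have "C \<subseteq> {y \<in> S. reach E S x y}"
    using assms x reach_mono[of E C x _ S] unfolding conn_def by blast
  moreover have "{y \<in> S. reach E S x y} \<in> comps E S"
    unfolding comps_def using x assms(3) by auto
  ultimately show ?thesis using that by blast
qed

text \<open>A path that starts on one side never crosses to the other, so components can be computed
  side by side. Every computation of the components left by a deleted vertex rests on this.\<close>

lemma comps_Un:
  assumes "S \<inter> T = {}"
    and "\<And>x y. x \<in> S \<Longrightarrow> y \<in> T \<Longrightarrow> \<not> E x y" "\<And>x y. x \<in> S \<Longrightarrow> y \<in> T \<Longrightarrow> \<not> E y x"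
  shows "comps E (S \<union> T) = comps E S \<union> comps E T"
proof -
  have *: "{y \<in> S \<union> T. reach E (S \<union> T) x y} = {y \<in> S. reach E S x y}" if "x \<in> S" for x
    using that reach_confined[of E "S \<union> T" x _ S] assms(2) reach_mono[of E S x _ "S \<union> T"] by blast
  have **: "{y \<in> S \<union> T. reach E (S \<union> T) x y} = {y \<in> T. reach E T x y}" if "x \<in> T" for x
    using that reach_confined[of E "S \<union> T" x _ T] assms(3) reach_mono[of E T x _ "S \<union> T"] by blast
  have "comps E (S \<union> T) = (\<lambda>x. {y \<in> S \<union> T. reach E (S \<union> T) x y}) ` S \<union>
      (\<lambda>x. {y \<in> S \<union> T. reach E (S \<union> T) x y}) ` T"
    unfolding comps_def by auto
  also have "\<dots> = (\<lambda>x. {y \<in> S. reach E S x y}) ` S \<union> (\<lambda>x. {y \<in> T. reach E T x y}) ` T"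
    using * ** by simp
  also have "\<dots> = comps E S \<union> comps E T"
    unfolding comps_def by auto
  finally show ?thesis .
qed

text \<open>A component consists of the points reachable from a representative \<open>z\<close>.
  Symmetry allows walking from any point back to \<open>z\<close>, hence to every other point, and
  the path stays in \<open>H\<close> because \<open>H\<close> is closed under edges of
  \<open>S\<close>.\<close>

lemma
  assumes "H \<in> comps E S" and sym: "\<And>x y. x \<in> S \<Longrightarrow> y \<in> S \<Longrightarrow> E x y \<Longrightarrow> E y x"
  shows comp_closed: "\<And>x y. x \<in> H \<Longrightarrow> y \<in> S \<Longrightarrow> E x y \<Longrightarrow> y \<in> H"
    and comp_conn: "conn E H"
    and comp_subset: "H \<subseteq> S"
    and comp_nonempty: "H \<noteq> {}"
proof -
  obtain z where z: "z \<in> S" and H: "H = {y \<in> S. reach E S z y}"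
    using assms(1) unfolding comps_def by auto
  show sub: "H \<subseteq> S" using H by auto
  show "H \<noteq> {}" using H z by auto
  show cl: "y \<in> H" if "x \<in> H" "y \<in> S" "E x y" for x y
    using that H by (auto intro: reach_trans reach_step)
  have "reach E H x y" if "x \<in> H" "y \<in> H" for x y
  proof -
    have "reach E S x y"
    proof (rule reach_trans)
      show "reach E S x z" using that(1) H reach_sym[of E S z x] sym by blast
      show "reach E S z y" using that(2) H by auto
    qed
    then show ?thesis using reach_confined[of E S x y H] that(1) sub cl by blast
  qed
  then show "conn E H" unfolding conn_def by blast
qed

lemma comps_disjoint:
  assumes "H \<in> comps E S" "H' \<in> comps E S" "H \<noteq> H'"
    and sym: "\<And>x y. x \<in> S \<Longrightarrow> y \<in> S \<Longrightarrow> E x y \<Longrightarrow> E y x"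
  shows "H \<inter> H' = {}"
proof -
  obtain z z' where z: "H = {y \<in> S. reach E S z y}" "H' = {y \<in> S. reach E S z' y}"
    using assms(1,2) unfolding comps_def by auto
  show ?thesis
  proof (rule ccontr)
    assume "H \<inter> H' \<noteq> {}"
    then obtain y where "reach E S z y" "reach E S z' y" using z by auto
    moreover have "reach E S y z" "reach E S y z'"
      using calculation reach_sym[of E S z y] reach_sym[of E S z' y] sym by blast+
    ultimately have "reach E S z z'" "reach E S z' z"
      by (blast intro: reach_trans)+
    then have "H = H'" unfolding z by (auto intro: reach_trans)
    then show False using assms(3) by simp
  qed
qed

text \<open>No edge joins \<open>H\<close> to the rest of \<open>S\<close>, so removing
  \<open>H\<close> leaves the other components intact. This allows a single child of a search tree
  to be replaced.\<close>

lemma comps_split: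
  assumes H: "H \<in> comps E S" and sym: "\<And>x y. x \<in> S \<Longrightarrow> y \<in> S \<Longrightarrow> E x y \<Longrightarrow> E y x"
  shows "comps E (S - H) = comps E S - {H}"
proof -
  note cl = comp_closed[OF H sym] and sub = comp_subset[OF H sym]
    and cn = comp_conn[OF H sym] and ne = comp_nonempty[OF H sym]
  have "comps E (H \<union> (S - H)) = comps E H \<union> comps E (S - H)"
    using cl sub sym by (intro comps_Un) blast+
  moreover have "H \<union> (S - H) = S" using sub by auto
  moreover have "comps E H = {H}" using comps_conn[OF cn ne] .
  moreover have "H \<notin> comps E (S - H)"
    using Union_comps[of E "S - H"] ne by blast
  ultimately show ?thesis by auto
qed

subsection \<open>Search trees\<close>

lemma verts_search_tree: "search_tree E S T \<Longrightarrow> verts T = S"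
proof (cases T)
  case (Node r ts)
  assume "search_tree E S T"
  then have "r \<in> S" "set (map verts ts) = comps E (S - {r})" using Node by auto
  moreover have "(\<Union>t\<in>set ts. verts t) = \<Union> (set (map verts ts))" by simp
  ultimately show ?thesis using Node Union_comps[of E "S - {r}"] by auto
qed

lemma search_tree_cong:
  assumes "\<And>x y. x \<in> S \<Longrightarrow> y \<in> S \<Longrightarrow> E x y = E' x y"
  shows "search_tree E S T = search_tree E' S T"
  using assms
proof (induction T arbitrary: S)
  case (Node r ts)
  have c: "comps E (S - {r}) = comps E' (S - {r})"
    using Node.prems by (intro comps_cong) auto
  have "search_tree E (verts t) t = search_tree E' (verts t) t"
    if t: "t \<in> set ts" and st: "set (map verts ts) = comps E (S - {r})" for t
  proof -
    have "verts t \<subseteq> S" using Union_comps[of E "S - {r}"] st t by auto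
    then show ?thesis using Node.prems by (intro Node.IH[OF t]) auto
  qed
  then show ?case using c by auto
qed

lemma cost_d_cong:
  assumes "\<And>x. x \<in> verts T \<Longrightarrow> w x = w' x"
  shows "cost_d w d T = cost_d w' d T"
  using assms
proof (induction T arbitrary: d)
  case (Node r ts)
  have "map (cost_d w (Suc d)) ts = map (cost_d w' (Suc d)) ts"
    unfolding map_eq_conv using Node by auto
  then have "sum_list (map (cost_d w (Suc d)) ts) = sum_list (map (cost_d w' (Suc d)) ts)"
    by (rule arg_cong)
  then show ?case using Node.prems[of r] by simp
qed

lemma subtrees_verts: "X \<in> subtrees T \<Longrightarrow> verts X \<subseteq> verts T"
  by (induction T) auto

lemma root_in_verts: "root T \<in> verts T"
  by (cases T) auto

lemma centroid_tree_cong: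
  assumes E: "\<And>x y. x \<in> V \<Longrightarrow> y \<in> V \<Longrightarrow> E x y = E' x y"
    and w: "\<And>x. x \<in> V \<Longrightarrow> w x = w' x"
  shows "centroid_tree V E w T = centroid_tree V E' w' T"
proof (cases "search_tree E V T")
  case True
  have "is_centroid E w (verts X) (root X) = is_centroid E' w' (verts X) (root X)"
    if "X \<in> subtrees T" for X
  proof -
    have sub: "verts X \<subseteq> V"
      using subtrees_verts[OF that] verts_search_tree[OF True] by simp
    have c: "comps E (verts X - {root X}) = comps E' (verts X - {root X})"
      using sub E by (intro comps_cong) auto
    have s: "sum w H = sum w' H" if "H \<subseteq> verts X" for H
      using that sub w by (intro sum.cong) auto
    have "H \<subseteq> verts X" if "H \<in> comps E' (verts X - {root X})" for H
      using that Union_comps[of E' "verts X - {root X}"] by auto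
    then show ?thesis unfolding is_centroid_def c using s by (auto simp: s)
  qed
  then show ?thesis
    using search_tree_cong[of V E E' T] E unfolding centroid_tree_def by auto
next
  case False
  then show ?thesis
    using search_tree_cong[of V E E' T] E unfolding centroid_tree_def by auto
qed

section \<open>Ancestor pairs and the cost of a search tree\<close>

definition anc_pairs :: "'a stree \<Rightarrow> ('a \<times> 'a) set" where
  "anc_pairs T = (\<Union>X\<in>subtrees T. {root X} \<times> verts X)"

lemma anc_pairs_Node: "anc_pairs (Node r ts) = {r} \<times> verts (Node r ts) \<union> (\<Union>t\<in>set ts. anc_pairs t)"
  unfolding anc_pairs_def by auto

lemma anc_pairs_subset: "anc_pairs T \<subseteq> verts T \<times> verts T"
  unfolding anc_pairs_def using subtrees_verts root_in_verts by fastforce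

context
  fixes E :: "'a \<Rightarrow> 'a \<Rightarrow> bool" and V :: "'a set"
  assumes finV: "finite V" and sym: "\<And>x y. x \<in> V \<Longrightarrow> y \<in> V \<Longrightarrow> E x y \<Longrightarrow> E y x"
begin

text \<open>Distinct children span distinct components, hence disjoint vertex sets that partition
  \<open>S - {r}\<close>. Sums over the list of children thereby become sums over a set.\<close>

lemma search_tree_NodeD:
  assumes "search_tree E S (Node r ts)" "S \<subseteq> V"
  shows "r \<in> S" "distinct ts" "inj_on verts (set ts)" "verts ` set ts = comps E (S - {r})"
    "\<And>t. t \<in> set ts \<Longrightarrow> search_tree E (verts t) t"
    "\<And>t. t \<in> set ts \<Longrightarrow> verts t \<subseteq> S - {r}"
    "\<And>t s. t \<in> set ts \<Longrightarrow> s \<in> set ts \<Longrightarrow> t \<noteq> s \<Longrightarrow> verts t \<inter> verts s = {}"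
    "(\<Union>t\<in>set ts. verts t) = S - {r}"
proof -
  show r: "r \<in> S" and st: "verts ` set ts = comps E (S - {r})"
    and "\<And>t. t \<in> set ts \<Longrightarrow> search_tree E (verts t) t"
    using assms(1) by auto
  show inj: "distinct ts" "inj_on verts (set ts)"
    using assms(1) by (auto simp: distinct_map)
  show un: "(\<Union>t\<in>set ts. verts t) = S - {r}"
    using st Union_comps by metis
  then show "\<And>t. t \<in> set ts \<Longrightarrow> verts t \<subseteq> S - {r}" by blast
  show "verts t \<inter> verts s = {}" if "t \<in> set ts" "s \<in> set ts" "t \<noteq> s" for t s
  proof (rule comps_disjoint[of _ E "S - {r}"])
    show "verts t \<in> comps E (S - {r})" "verts s \<in> comps E (S - {r})"
      using st that by auto
    show "verts t \<noteq> verts s" using inj that by (auto dest: inj_onD)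
    show "\<And>x y. x \<in> S - {r} \<Longrightarrow> y \<in> S - {r} \<Longrightarrow> E x y \<Longrightarrow> E y x"
      using sym assms(2) by blast
  qed
qed

text \<open>Moving a tree down one level raises every depth by one and so adds the total
  weight.\<close>

lemma cost_d_Suc:
  assumes "search_tree E S T" "S \<subseteq> V"
  shows "cost_d w (Suc d) T = cost_d w d T + sum w S"
  using assms
proof (induction T arbitrary: S d)
  case (Node r ts)
  note D = search_tree_NodeD[OF Node.prems]
  have fin: "finite S" using Node.prems finV finite_subset by blast
  have finv: "finite (verts t)" if "t \<in> set ts" for t
    using D(6)[OF that] fin by (meson Diff_subset finite_subset)
  have "cost_d w (Suc (Suc d)) t = cost_d w (Suc d) t + sum w (verts t)" if "t \<in> set ts" for t
    using Node.IH[OF that D(5)[OF that]] D(6)[OF that] Node.prems(2) by blast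
  then have "sum_list (map (cost_d w (Suc (Suc d))) ts)
      = (\<Sum>t\<in>set ts. cost_d w (Suc d) t + sum w (verts t))"
    using D(2) by (simp add: sum_list_distinct_conv_sum_set)
  also have "\<dots> = sum_list (map (cost_d w (Suc d)) ts) + (\<Sum>t\<in>set ts. sum w (verts t))"
    using D(2) by (simp add: sum_list_distinct_conv_sum_set sum.distrib)
  also have "(\<Sum>t\<in>set ts. sum w (verts t)) = sum w (\<Union>t\<in>set ts. verts t)"
    using D(7) finv by (intro sum.UNION_disjoint[symmetric]) auto
  also have "\<dots> = sum w S - w r"
    using D(1,8) fin by (simp add: sum_diff1)
  finally show ?case by (simp add: algebra_simps)
qed

text \<open>A vertex is paired with each of its ancestors and with itself, so the number of its
  pairs is its depth when the root has depth 1, which is the case \<open>d = 0\<close>. In the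
  induction the pairs split into those from the root \<open>r\<close> to all of \<open>S\<close> and
  those within the children.\<close>

lemma cost_d_pairs:
  assumes "search_tree E S T" "S \<subseteq> V"
  shows "cost_d w (Suc d) T = real d * sum w S + (\<Sum>(y, x)\<in>anc_pairs T. w x)"
  using assms
proof (induction T arbitrary: S d)
  case (Node r ts)
  note D = search_tree_NodeD[OF Node.prems]
  have fin: "finite S" using Node.prems finV finite_subset by blast
  have finv: "finite (verts t)" if "t \<in> set ts" for t
    using D(6)[OF that] fin by (meson Diff_subset finite_subset)
  have vS: "verts (Node r ts) = S" using verts_search_tree[OF Node.prems(1)] .
  have finp: "finite (anc_pairs t)" if "t \<in> set ts" for t
    using finv[OF that] anc_pairs_subset[of t] by (meson finite_SigmaI finite_subset)
  have "cost_d w (Suc (Suc d)) t = real (Suc d) * sum w (verts t) + (\<Sum>(y, x)\<in>anc_pairs t. w x)"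
    if "t \<in> set ts" for t
    using Node.IH[OF that D(5)[OF that]] D(6)[OF that] Node.prems(2) by blast
  then have "sum_list (map (cost_d w (Suc (Suc d))) ts)
      = (\<Sum>t\<in>set ts. real (Suc d) * sum w (verts t) + (\<Sum>(y, x)\<in>anc_pairs t. w x))"
    using D(2) by (simp add: sum_list_distinct_conv_sum_set)
  also have "\<dots> = real (Suc d) * (\<Sum>t\<in>set ts. sum w (verts t))
      + (\<Sum>t\<in>set ts. \<Sum>(y, x)\<in>anc_pairs t. w x)"
    by (simp add: sum.distrib sum_distrib_left)
  also have "(\<Sum>t\<in>set ts. sum w (verts t)) = sum w (\<Union>t\<in>set ts. verts t)"
    using D(7) finv by (intro sum.UNION_disjoint[symmetric]) auto
  also have "\<dots> = sum w S - w r"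
    using D(1,8) fin by (simp add: sum_diff1)
  also have "(\<Sum>t\<in>set ts. \<Sum>(y, x)\<in>anc_pairs t. w x)
      = (\<Sum>(y, x)\<in>(\<Union>t\<in>set ts. anc_pairs t). w x)"
  proof (intro sum.UNION_disjoint[symmetric] ballI impI)
    fix t s assume "t \<in> set ts" "s \<in> set ts" "t \<noteq> s"
    then have "verts t \<inter> verts s = {}" by (rule D(7))
    then show "anc_pairs t \<inter> anc_pairs s = {}"
      using anc_pairs_subset[of t] anc_pairs_subset[of s] by blast
  qed (use finp in auto)
  finally have 1: "sum_list (map (cost_d w (Suc (Suc d))) ts) =
      real (Suc d) * (sum w S - w r) + (\<Sum>(y, x)\<in>(\<Union>t\<in>set ts. anc_pairs t). w x)" .
  have "(\<Sum>(y, x)\<in>anc_pairs (Node r ts). w x)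
      = (\<Sum>(y, x)\<in>{r} \<times> S. w x) + (\<Sum>(y, x)\<in>(\<Union>t\<in>set ts. anc_pairs t). w x)"
    unfolding anc_pairs_Node vS
  proof (rule sum.union_disjoint)
    show "{r} \<times> S \<inter> (\<Union>t\<in>set ts. anc_pairs t) = {}"
      using D(6) anc_pairs_subset by fastforce
  qed (use fin finp in auto)
  moreover have "(\<Sum>(y, x)\<in>{r} \<times> S. w x) = sum w S"
    by (simp add: sum.cartesian_product[symmetric])
  ultimately show ?case using 1 by (simp add: algebra_simps)
qed

end

text \<open>The pairs (ancestor, descendant) of a search tree have this property, which, unlike being a
  search tree, passes to subsets of the vertices without any change.\<close>
definition dominates :: "('a \<Rightarrow> 'a \<Rightarrow> bool) \<Rightarrow> 'a set \<Rightarrow> ('a \<times> 'a) set \<Rightarrow> bool" where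
  "dominates E V P \<longleftrightarrow> (\<forall>C. C \<noteq> {} \<longrightarrow> C \<subseteq> V \<longrightarrow> conn E C \<longrightarrow> (\<exists>r\<in>C. {r} \<times> C \<subseteq> P))"

lemma dominatesD:
  "dominates E V P \<Longrightarrow> C \<noteq> {} \<Longrightarrow> C \<subseteq> V \<Longrightarrow> conn E C \<Longrightarrow> \<exists>r\<in>C. {r} \<times> C \<subseteq> P"
  by (simp add: dominates_def)

lemma dominates_mono: "dominates E V P \<Longrightarrow> A \<subseteq> V \<Longrightarrow> dominates E A P"
  unfolding dominates_def by (meson order_trans)

text \<open>On the way down from the root, a connected set \<open>C\<close> stays inside one
  component until one of its own vertices is deleted. That vertex is an ancestor of all of
  \<open>C\<close>.\<close>

lemma dominates_anc_pairs:
  assumes "search_tree E S T"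
  shows "dominates E S (anc_pairs T)"
  using assms
proof (induction T arbitrary: S)
  case (Node r ts)
  have vS: "verts (Node r ts) = S" using verts_search_tree[OF Node.prems] .
  show ?case
    unfolding dominates_def
  proof (intro allI impI)
    fix C assume C: "C \<noteq> {}" "C \<subseteq> S" "conn E C"
    show "\<exists>r'\<in>C. {r'} \<times> C \<subseteq> anc_pairs (Node r ts)"
    proof (cases "r \<in> C")
      case True
      then show ?thesis using C vS by (intro bexI[of _ r]) (auto simp: anc_pairs_Node)
    next
      case False
      then have "C \<subseteq> S - {r}" using C by auto
      then obtain H where H: "H \<in> comps E (S - {r})" "C \<subseteq> H"
        using conn_in_comp[OF C(3,1)] by blast
      then have "H \<in> set (map verts ts)" using Node.prems by simp
      then obtain t where t: "t \<in> set ts" "H = verts t" by auto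
      then have "dominates E H (anc_pairs t)" using Node.IH[of t H] Node.prems by simp
      then obtain r' where "r' \<in> C" "{r'} \<times> C \<subseteq> anc_pairs t"
        using dominatesD[of E H "anc_pairs t" C] C(1,3) H(2) by blast
      moreover have "anc_pairs t \<subseteq> anc_pairs (Node r ts)"
        using t(1) unfolding anc_pairs_Node by blast
      ultimately show ?thesis by blast
    qed
  qed
qed

text \<open>The new vertex \<open>u\<close> follows the component of \<open>a\<close> down the tree
  and becomes a leaf child of \<open>a\<close>, where the deletion of \<open>a\<close> isolates it.
  No other depth changes, and the depth of \<open>u\<close> is at most \<open>d + card S\<close>
  because the vertex set shrinks at every level.\<close>

lemma pendant_search_tree:
  fixes w :: "'a \<Rightarrow> real"
  assumes "search_tree E S T" "finite S" "u \<notin> S" "a \<in> S" "w u \<ge> 0"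
    and "\<And>x y. x \<in> S \<Longrightarrow> y \<in> S \<Longrightarrow> E x y \<Longrightarrow> E y x"
    and "\<And>x. x \<in> S \<Longrightarrow> E x u = (x = a)" "\<And>x. x \<in> S \<Longrightarrow> E u x = (x = a)"
  shows "\<exists>T'. search_tree E (insert u S) T' \<and>
           cost_d w d T' \<le> cost_d w d T + w u * real (d + card S)"
  using assms
proof (induction T arbitrary: S d)
  case (Node r ts)
  note sym = Node.prems(6) and Eu = Node.prems(7,8)
  have r: "r \<in> S" and dst: "distinct (map verts ts)"
    and st: "set (map verts ts) = comps E (S - {r})"
    and sub: "\<And>t. t \<in> set ts \<Longrightarrow> search_tree E (verts t) t"
    using Node.prems(1) by auto
  have ur: "u \<noteq> r" using r Node.prems by auto
  have sym': "\<And>x y. x \<in> S - {r} \<Longrightarrow> y \<in> S - {r} \<Longrightarrow> E x y \<Longrightarrow> E y x" using sym by auto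
  show ?case
  proof (cases "r = a")
    case True
    let ?T = "Node r (Node u [] # ts)"
    have "comps E ({u} \<union> (S - {r})) = comps E {u} \<union> comps E (S - {r})"
      using Node.prems(3) Eu True by (intro comps_Un) auto
    moreover have "{u} \<union> (S - {r}) = insert u S - {r}" using ur by auto
    moreover have "comps E {u} = {{u}}" by (simp add: comps_conn)
    ultimately have c: "comps E (insert u S - {r}) = insert {u} (comps E (S - {r}))" by simp
    have "{u} \<notin> comps E (S - {r})"
      using Union_comps[of E "S - {r}"] Node.prems(3) by blast
    then have "search_tree E (insert u S) ?T"
      using r dst st sub c by auto
    moreover have "cost_d w d ?T \<le> cost_d w d (Node r ts) + w u * real (d + card S)"
    proof -
      have "card S \<ge> 1" using r Node.prems(2) by (metis card_gt_0_iff empty_iff less_eq_Suc_le One_nat_def)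
      then have "real (Suc d) * w u \<le> real (d + card S) * w u"
        using Node.prems(5) by (intro mult_right_mono) auto
      then show ?thesis by (simp add: algebra_simps)
    qed
    ultimately show ?thesis by blast
  next
    case False
    then have "a \<in> \<Union> (comps E (S - {r}))" using Node.prems(4) Union_comps by (metis insert_Diff insert_iff r)
    then obtain t where t: "t \<in> set ts" "a \<in> verts t" 
      unfolding st[symmetric] by auto
    have H: "verts t \<in> comps E (S - {r})" using t st by auto
    have tS: "verts t \<subseteq> S - {r}" using comp_subset[OF H sym'] .
    have fint: "finite (verts t)" using tS Node.prems(2) by (meson Diff_subset finite_subset)
    have ut: "u \<notin> verts t" using tS Node.prems(3) by auto
    have symt: "\<And>x y. x \<in> verts t \<Longrightarrow> y \<in> verts t \<Longrightarrow> E x y \<Longrightarrow> E y x"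
      and Eut: "\<And>x. x \<in> verts t \<Longrightarrow> E x u = (x = a)" "\<And>x. x \<in> verts t \<Longrightarrow> E u x = (x = a)"
      using tS sym Eu by blast+
    obtain T' where T': "search_tree E (insert u (verts t)) T'"
      "cost_d w (Suc d) T' \<le> cost_d w (Suc d) t + w u * real (Suc d + card (verts t))"
      using Node.IH[OF t(1) sub[OF t(1)] fint ut t(2) Node.prems(5) symt Eut, of "Suc d"] by blast
    have vT': "verts T' = insert u (verts t)" using verts_search_tree[OF T'(1)] .
    obtain ts1 ts2 where ts: "ts = ts1 @ t # ts2" using t(1) split_list by metis
    let ?T = "Node r (ts1 @ T' # ts2)"
    \<comment> \<open>Among the components of \<open>S - {r}\<close> only the one containing
      \<open>a\<close> changes: it gains \<open>u\<close>.\<close>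
    have "comps E ((S - {r} - verts t) \<union> insert u (verts t))
        = comps E (S - {r} - verts t) \<union> comps E (insert u (verts t))"
    proof (rule comps_Un)
      fix x y assume x: "x \<in> S - {r} - verts t" and y: "y \<in> insert u (verts t)"
      have "\<not> E y x" 
        using x y comp_closed[OF H sym', of y x] Eu t(2) by auto
      moreover have "\<not> E x y"
      proof (cases "y = u")
        case True
        then show ?thesis using Eu(1)[of x] x t(2) by auto
      next
        case False
        then have "y \<in> S - {r}" using y tS by auto
        then show ?thesis using \<open>\<not> E y x\<close> sym'[of x y] x by auto
      qed
      ultimately show "\<not> E x y" "\<not> E y x" by auto
    qed (use Node.prems(3) in auto)
    moreover have "(S - {r} - verts t) \<union> insert u (verts t) = insert u S - {r}"
      using tS ur by auto
    moreover have "comps E (insert u (verts t)) = {insert u (verts t)}"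
    proof -
      have "conn E ({u} \<union> verts t)"
        using comp_conn[OF H sym'] t(2) Eu[of a] Node.prems(4) by (intro conn_Un[of E "{u}" "verts t" u a]) auto
      then show ?thesis by (intro comps_conn) auto
    qed
    ultimately have c: "comps E (insert u S - {r}) = insert (insert u (verts t)) (comps E (S - {r}) - {verts t})"
      using comps_split[OF H sym'] by auto
    have c2: "comps E (S - {r}) - {verts t} = set (map verts (ts1 @ ts2))"
      using dst unfolding st[symmetric] ts by auto
    have nin: "insert u (verts t) \<notin> comps E (S - {r})"
      using Union_comps[of E "S - {r}"] Node.prems(3) by blast
    have "distinct (map verts (ts1 @ T' # ts2))"
      using dst nin unfolding st[symmetric] ts by (auto simp: vT')
    moreover have "set (map verts (ts1 @ T' # ts2)) = comps E (insert u S - {r})"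
      unfolding c c2 by (auto simp: vT')
    moreover have "\<forall>s\<in>set (ts1 @ T' # ts2). search_tree E (verts s) s"
      using sub T' vT' unfolding ts by auto
    ultimately have "search_tree E (insert u S) ?T" using r by simp
    moreover have "cost_d w d ?T \<le> cost_d w d (Node r ts) + w u * real (d + card S)"
    proof -
      \<comment> \<open>The child lacks at least the vertex \<open>r\<close>, which pays for the
        extra level in the depth bound of \<open>u\<close>.\<close>
      have "card (verts t) \<le> card (S - {r})" using tS Node.prems(2) by (intro card_mono) auto
      also have "\<dots> < card S" using r Node.prems(2) by (meson card_Diff1_less)
      finally have "w u * real (Suc d + card (verts t)) \<le> w u * real (d + card S)"
        using Node.prems(5) by (intro mult_left_mono) auto
      then show ?thesis using T'(2) unfolding ts by simp
    qed
    ultimately show ?thesis by blast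
  qed
qed

subsection \<open>Joining two weighted trees\<close>

text \<open>The attachment vertex \<open>a\<close> has its own degree bound \<open>d\<close>, since
  the gap between \<open>d\<close> and \<open>D\<close> is the room for further joins at
  \<open>a\<close>. Nothing is demanded of \<open>E\<close> outside \<open>V\<close>, so several
  trees can share one edge relation.\<close>

definition wtree ::
  "nat \<Rightarrow> 'a set \<Rightarrow> ('a \<Rightarrow> 'a \<Rightarrow> bool) \<Rightarrow> ('a \<Rightarrow> real) \<Rightarrow> 'a \<Rightarrow> nat \<Rightarrow> real \<Rightarrow> nat \<Rightarrow> bool" where
  "wtree D V E w a d W n \<longleftrightarrow> finite V \<and> a \<in> V \<and> conn E V
     \<and> (\<forall>x\<in>V. \<forall>y\<in>V. E x y \<longrightarrow> E y x \<and> x \<noteq> y)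
     \<and> card {(x, y). x \<in> V \<and> y \<in> V \<and> E x y} = 2 * (card V - 1)
     \<and> max_deg_le V E D \<and> card {y \<in> V. E a y} \<le> d
     \<and> (\<forall>x\<in>V. 0 \<le> w x) \<and> sum w V = W \<and> card V = n"

text \<open>For the ancestor pairs of a search tree on \<open>V\<close> this is its cost.
  Restricting to pairs inside \<open>V\<close> lets the same \<open>P\<close> be measured on a part
  of a larger tree.\<close>

definition pair_weight :: "'a set \<Rightarrow> ('a \<Rightarrow> real) \<Rightarrow> ('a \<times> 'a) set \<Rightarrow> real" where
  "pair_weight V w P = (\<Sum>(y, x)\<in>P \<inter> V \<times> V. w x)"

text \<open>\<open>C\<close> is the cost of all centroid trees, \<open>L\<close> and \<open>U\<close> bound the optimum, and
  \<open>rooted\<close> asks that \<open>U\<close> be attained with \<open>a\<close> as the root.\<close>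
definition gadget ::
  "nat \<Rightarrow> bool \<Rightarrow> 'a set \<Rightarrow> ('a \<Rightarrow> 'a \<Rightarrow> bool) \<Rightarrow> ('a \<Rightarrow> real) \<Rightarrow> 'a \<Rightarrow> nat \<Rightarrow> real \<Rightarrow> nat
    \<Rightarrow> real \<Rightarrow> real \<Rightarrow> real \<Rightarrow> bool" where
  "gadget D rooted V E w a d W n C L U \<longleftrightarrow> wtree D V E w a d W n
     \<and> (\<forall>T. centroid_tree V E w T \<longrightarrow> cost w T = C)
     \<and> (\<forall>P. dominates E V P \<longrightarrow> L \<le> pair_weight V w P)
     \<and> (\<exists>T. search_tree E V T \<and> (rooted \<longrightarrow> root T = a) \<and> cost w T \<le> U)"

text \<open>All ingredients look at edges and weights inside \<open>V\<close> only. Gadgets built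
  separately on disjoint vertex sets can therefore be placed under one common \<open>E\<close> and
  \<open>w\<close>.\<close>

lemma gadget_cong:
  assumes "gadget D rooted V E w a d W n C L U"
    and E: "\<And>x y. x \<in> V \<Longrightarrow> y \<in> V \<Longrightarrow> E x y = E' x y" and w: "\<And>x. x \<in> V \<Longrightarrow> w x = w' x"
  shows "gadget D rooted V E' w' a d W n C L U"
proof -
  have W: "wtree D V E w a d W n" using assms(1) by (simp add: gadget_def)
  have a: "a \<in> V" using W by (simp add: wtree_def)
  have c: "cost w T = cost w' T" if "search_tree E V T" for T
    unfolding cost_def using w verts_search_tree[OF that] by (intro cost_d_cong) auto
  have nb: "{y \<in> V. E' x y} = {y \<in> V. E x y}" if "x \<in> V" for x
    using E that by auto
  have eqs: "{(x, y). x \<in> V \<and> y \<in> V \<and> E' x y} = {(x, y). x \<in> V \<and> y \<in> V \<and> E x y}"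
    "max_deg_le V E' D = max_deg_le V E D" "conn E' V = conn E V" "sum w' V = sum w V"
    "(\<forall>x\<in>V. \<forall>y\<in>V. E' x y \<longrightarrow> E' y x \<and> x \<noteq> y) = (\<forall>x\<in>V. \<forall>y\<in>V. E x y \<longrightarrow> E y x \<and> x \<noteq> y)"
    "(\<forall>x\<in>V. 0 \<le> w' x) = (\<forall>x\<in>V. 0 \<le> w x)"
    using E w conn_cong[of V E E'] by (auto simp: max_deg_le_def nb)
  have "wtree D V E' w' a d W n = wtree D V E w a d W n"
    unfolding wtree_def eqs nb[OF a] ..
  then have "wtree D V E' w' a d W n" using W by simp
  moreover have "cost w' T = C" if "centroid_tree V E' w' T" for T
  proof -
    have T: "centroid_tree V E w T" using that centroid_tree_cong[of V E E' w w' T] E w by simp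
    then have "search_tree E V T" by (simp add: centroid_tree_def)
    moreover have "cost w T = C" using T assms(1) by (simp add: gadget_def)
    ultimately show ?thesis using c[of T] by simp
  qed
  moreover have "L \<le> pair_weight V w' P" if "dominates E' V P" for P
  proof -
    have "conn E C = conn E' C" if "C \<subseteq> V" for C
      using that E by (intro conn_cong) auto
    then have "dominates E V P" using that unfolding dominates_def by auto
    then have "L \<le> pair_weight V w P" using assms(1) by (simp add: gadget_def)
    moreover have "pair_weight V w P = pair_weight V w' P"
      unfolding pair_weight_def using w by (intro sum.cong) auto
    ultimately show ?thesis by simp
  qed
  moreover have "\<exists>T. search_tree E' V T \<and> (rooted \<longrightarrow> root T = a) \<and> cost w' T \<le> U"
  proof -
    obtain T where "search_tree E V T \<and> (rooted \<longrightarrow> root T = a) \<and> cost w T \<le> U"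
      using assms(1) unfolding gadget_def by blast
    then show ?thesis using c[of T] search_tree_cong[of V E E' T] E by auto
  qed
  ultimately show ?thesis unfolding gadget_def by blast
qed

lemma gadget_weaken:
  assumes "gadget D rooted V E w a d W n C L U" "d \<le> d'"
  shows "gadget D False V E w a d' W n C L U"
  using assms unfolding gadget_def wtree_def by (auto intro: order_trans)

text \<open>The strict bounds on \<open>dA\<close> and \<open>dB\<close> leave room for the edges to
  \<open>u\<close>, and \<open>2 \<le> D\<close> covers \<open>u\<close> itself. Equal weights on
  both sides together with \<open>0 < w u\<close> force every centroid to be
  \<open>u\<close>.\<close>

locale tree_join =
  fixes D :: nat and E :: "'a \<Rightarrow> 'a \<Rightarrow> bool" and w :: "'a \<Rightarrow> real"
    and A B :: "'a set" and a b u :: 'a and dA dB nA nB :: nat and WA :: real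
  assumes wtA: "wtree D A E w a dA WA nA" and wtB: "wtree D B E w b dB WA nB"
    and disj: "A \<inter> B = {}" and uA: "u \<notin> A" and uB: "u \<notin> B"
    and noAB: "\<And>x y. x \<in> A \<Longrightarrow> y \<in> B \<Longrightarrow> \<not> E x y \<and> \<not> E y x"
    and Eu: "\<And>x. x \<in> A \<union> B \<Longrightarrow> E x u = (x = a \<or> x = b)" "\<And>x. x \<in> A \<union> B \<Longrightarrow> E u x = (x = a \<or> x = b)"
    and uu: "\<not> E u u"
    and dA: "dA < D" and dB: "dB < D" and D: "2 \<le> D" and wu: "0 < w u"
begin

abbreviation J :: "'a set" where "J \<equiv> insert u (A \<union> B)"

text \<open>The two sides play symmetric parts, so a fact proved for \<open>A\<close> transfers to
  \<open>B\<close>.\<close>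

lemma swap: "tree_join D E w B A b a u dB dA nB nA WA"
  using wtA wtB disj uA uB noAB Eu uu dA dB D wu by unfold_locales auto

lemma ab: "a \<in> A" "b \<in> B" "a \<notin> B" "b \<notin> A" "a \<noteq> b" "u \<noteq> a" "u \<noteq> b"
  and fin: "finite A" "finite B" and connA: "conn E A" and connB: "conn E B"
  and sumA: "sum w A = WA" and sumB: "sum w B = WA"
  using wtA wtB disj uA uB unfolding wtree_def by auto

section \<open>Connectivity, weight, edges and degrees of a join\<close>

lemma w_nonneg: "x \<in> J \<Longrightarrow> 0 \<le> w x"
  using wtA wtB wu unfolding wtree_def by auto

lemma symA: "x \<in> A \<Longrightarrow> y \<in> A \<Longrightarrow> E x y \<Longrightarrow> E y x \<and> x \<noteq> y"
  and symB: "x \<in> B \<Longrightarrow> y \<in> B \<Longrightarrow> E x y \<Longrightarrow> E y x \<and> x \<noteq> y"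
  using wtA wtB unfolding wtree_def by auto

lemma symJ: "x \<in> J \<Longrightarrow> y \<in> J \<Longrightarrow> E x y \<Longrightarrow> E y x \<and> x \<noteq> y"
  using symA symB noAB Eu uu by (elim insertE UnE) auto

lemma conn_uB: "conn E (insert u B)"
  using conn_Un[of E "{u}" B u b] connB ab Eu by auto

lemma connJ: "conn E J"
proof -
  have "conn E (A \<union> insert u B)"
    using conn_Un[OF connA conn_uB, of a u] ab Eu by auto
  then show ?thesis by simp
qed

lemma sumJ: "sum w J = w u + 2 * WA"
  using fin disj uA uB sumA sumB by (simp add: sum.union_disjoint)

lemma cardJ: "card J = nA + nB + 1"
  using fin disj uA uB wtA wtB by (simp add: card_Un_disjoint wtree_def)

lemma edgesJ: "card {(x, y). x \<in> J \<and> y \<in> J \<and> E x y} = 2 * (card J - 1)"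
proof -
  let ?e = "\<lambda>V. {(x, y). x \<in> V \<and> y \<in> V \<and> E x y}"
  let ?N = "{(a, u), (u, a), (b, u), (u, b)}"
  have fe: "finite (?e V)" if "finite V" for V
    by (rule finite_subset[of _ "V \<times> V"]) (use that in auto)
  have "?e J = (?e A \<union> ?e B) \<union> ?N"
  proof (intro set_eqI, clarify)
    fix x y
    show "((x, y) \<in> ?e J) = ((x, y) \<in> (?e A \<union> ?e B) \<union> ?N)"
      using noAB Eu uu ab disj uA uB by auto
  qed
  moreover have "card ((?e A \<union> ?e B) \<union> ?N) = card (?e A \<union> ?e B) + card ?N"
    using fe fin uA uB by (intro card_Un_disjoint) auto
  moreover have "card (?e A \<union> ?e B) = card (?e A) + card (?e B)"
    using fe fin disj by (intro card_Un_disjoint) auto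
  moreover have "card ?N = 4" using ab by auto
  moreover have "card (?e A) = 2 * (nA - 1)" "card (?e B) = 2 * (nB - 1)"
    using wtA wtB by (simp_all add: wtree_def)
  \<comment> \<open>With these the truncated subtractions are genuine, and
    \<open>2 * (nA - 1) + 2 * (nB - 1) + 4 = 2 * (nA + nB)\<close>.\<close>
  moreover have "nA \<ge> 1" "nB \<ge> 1"
    using wtA wtB ab fin by (auto simp: wtree_def Suc_le_eq card_gt_0_iff)
  ultimately show ?thesis using cardJ by simp
qed

lemma nbA: "x \<in> A \<Longrightarrow> {y \<in> J. E x y} = (if x = a then insert u {y \<in> A. E x y} else {y \<in> A. E x y})"
  using noAB[of x] Eu ab by auto

lemma nbB: "x \<in> B \<Longrightarrow> {y \<in> J. E x y} = (if x = b then insert u {y \<in> B. E x y} else {y \<in> B. E x y})"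
  using noAB[of _ x] Eu ab by auto

lemma nbu: "{y \<in> J. E u y} = {a, b}"
  using Eu ab uu by auto

lemma deg_b: "card {y \<in> J. E b y} \<le> Suc dB"
proof -
  have "card {y \<in> J. E b y} \<le> Suc (card {y \<in> B. E b y})"
    using nbB[OF ab(2)] fin by (simp add: card_insert_if)
  then show ?thesis using wtB by (simp add: wtree_def)
qed

lemma deg_a: "card {y \<in> J. E a y} \<le> Suc dA"
proof -
  have "card {y \<in> J. E a y} \<le> Suc (card {y \<in> A. E a y})"
    using nbA[OF ab(1)] fin by (simp add: card_insert_if)
  then show ?thesis using wtA by (simp add: wtree_def)
qed

lemma deg_u: "card {y \<in> J. E u y} \<le> 2"
  unfolding nbu using ab by simp

lemma max_degJ: "max_deg_le J E D"
  unfolding max_deg_le_def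
proof
  fix x assume "x \<in> J"
  then consider "x = u" | "x = a" | "x = b" | "x \<in> A" "x \<noteq> a" | "x \<in> B" "x \<noteq> b" by auto
  then show "card {y \<in> J. E x y} \<le> D"
  proof cases
    case 4
    then show ?thesis using nbA[of x] wtA by (simp add: wtree_def max_deg_le_def)
  next
    case 5
    then show ?thesis using nbB[of x] wtB by (simp add: wtree_def max_deg_le_def)
  qed (use deg_u deg_a deg_b dA dB D in auto)
qed

lemma wtreeJ:
  assumes "x = u \<and> d = 2 \<or> x = b \<and> d = Suc dB"
  shows "wtree D J E w x d (w u + 2 * WA) (nA + nB + 1)"
  unfolding wtree_def
proof (intro conjI ballI impI)
  show "card {y \<in> J. E x y} \<le> d" using assms deg_u deg_b by blast
  show "E z y" "y \<noteq> z" if "y \<in> J" "z \<in> J" "E y z" for y z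
    using symJ[OF that] by auto
qed (use fin connJ edgesJ max_degJ w_nonneg sumJ cardJ ab assms in \<open>simp_all only: finite_insert finite_Un, auto\<close>)

section \<open>Search trees, centroids and costs of a join\<close>

lemma comps_del_u: "comps E (J - {u}) = {A, B}"
proof -
  have "J - {u} = A \<union> B" using uA uB by auto
  moreover have "comps E (A \<union> B) = comps E A \<union> comps E B"
    using disj noAB by (intro comps_Un) auto
  moreover have "comps E A = {A}" "comps E B = {B}"
    using connA connB ab by (auto intro!: comps_conn)
  ultimately show ?thesis by auto
qed

text \<open>Deleting a vertex of \<open>A\<close> leaves \<open>insert u B\<close> in one component.
  Its weight is at least \<open>w u + WA\<close>, which exceeds half of the total
  \<open>w u + 2 * WA\<close>.\<close>

lemma centroid_not_in_A:
  assumes "is_centroid E w J r"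
  shows "r \<notin> A"
proof
  assume r: "r \<in> A"
  have "insert u B \<subseteq> J - {r}" using r uA disj by auto
  then obtain H where H: "H \<in> comps E (J - {r})" "insert u B \<subseteq> H"
    using conn_in_comp[OF conn_uB] by blast
  have HJ: "H \<subseteq> J" using H(1) Union_comps[of E "J - {r}"] by auto
  then have "finite H" using fin by (meson finite.insertI finite_UnI finite_subset)
  then have "sum w (insert u B) \<le> sum w H"
    using H(2) HJ w_nonneg by (intro sum_mono2) auto
  moreover have "sum w (insert u B) = w u + WA" using fin uB sumB by simp
  moreover have "sum w H \<le> sum w J / 2" using assms H(1) by (simp add: is_centroid_def)
  ultimately show False using sumJ wu by simp
qed

lemma centroid_eq_u:
  assumes "is_centroid E w J r"
  shows "r = u"
proof -
  have "r \<notin> A" using centroid_not_in_A[OF assms] .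
  moreover have "r \<notin> B" using tree_join.centroid_not_in_A[OF swap] assms by (simp add: Un_commute)
  moreover have "r \<in> J" using assms by (simp add: is_centroid_def)
  ultimately show ?thesis by auto
qed

text \<open>Below \<open>u\<close> hang exactly one search tree on \<open>A\<close> and one on
  \<open>B\<close>, in either order. Each is one level deeper than on its own and so pays an
  additional \<open>WA\<close>.\<close>

lemma Node_u:
  assumes "search_tree E J (Node u ts)"
  obtains s t where "search_tree E A s" "search_tree E B t" "set ts = {s, t}"
    "cost w (Node u ts) = w u + 2 * WA + cost w s + cost w t"
proof -
  have J: "finite J" using fin by simp
  have sJ: "\<And>x y. x \<in> J \<Longrightarrow> y \<in> J \<Longrightarrow> E x y \<Longrightarrow> E y x" using symJ by blast
  have dst: "distinct (map verts ts)" and st: "verts ` set ts = {A, B}"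
    and sub: "\<And>t. t \<in> set ts \<Longrightarrow> search_tree E (verts t) t"
    using assms comps_del_u by auto
  have inj: "inj_on verts (set ts)" "distinct ts" using dst by (auto simp: distinct_map)
  obtain s t where s: "s \<in> set ts" "verts s = A" and t: "t \<in> set ts" "verts t = B"
    using st by (metis imageE insertI1 insertI2)
  have stn: "s \<noteq> t" using s t disj ab by auto
  have ts: "set ts = {s, t}"
  proof (intro set_eqI iffI)
    fix x assume x: "x \<in> set ts"
    then have "verts x = verts s \<or> verts x = verts t" using st s t by auto
    then show "x \<in> {s, t}" using inj(1) x s t by (auto dest: inj_onD)
  qed (use s t in auto)
  have sA: "search_tree E A s" and tB: "search_tree E B t" using sub s t by auto
  have "cost_d w (Suc 1) s = cost_d w 1 s + WA"
    using cost_d_Suc[OF J sJ sA] sumA by auto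
  moreover have "cost_d w (Suc 1) t = cost_d w 1 t + WA"
    using cost_d_Suc[OF J sJ tB] sumB by auto
  moreover have "sum_list (map (cost_d w (Suc 1)) ts) = cost_d w (Suc 1) s + cost_d w (Suc 1) t"
    using inj(2) stn by (simp add: sum_list_distinct_conv_sum_set ts)
  ultimately have "cost w (Node u ts) = w u + 2 * WA + cost w s + cost w t"
    by (simp add: cost_def)
  then show ?thesis using that sA tB ts by blast
qed

text \<open>The root must be \<open>u\<close>, and the two subtrees inherit the centroid
  property.\<close>

lemma centroid_cost:
  assumes T: "centroid_tree J E w T"
    and A: "\<And>T. centroid_tree A E w T \<Longrightarrow> cost w T = CA"
    and B: "\<And>T. centroid_tree B E w T \<Longrightarrow> cost w T = CB"
  shows "cost w T = w u + 2 * WA + CA + CB"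
proof -
  obtain r ts where r: "T = Node r ts" by (cases T)
  have sT: "search_tree E J T" using T by (simp add: centroid_tree_def)
  have "T \<in> subtrees T" using r by simp
  then have "is_centroid E w (verts T) (root T)"
    using T unfolding centroid_tree_def by blast
  then have "r = u" using centroid_eq_u r verts_search_tree[OF sT] by simp
  then obtain s t where st: "search_tree E A s" "search_tree E B t" "set ts = {s, t}"
    "cost w T = w u + 2 * WA + cost w s + cost w t"
    using Node_u[of ts] sT r by blast
  have "centroid_tree A E w s" "centroid_tree B E w t"
    using st T r unfolding centroid_tree_def by auto
  then show ?thesis using st(4) A B by simp
qed

text \<open>The pairs inside \<open>A\<close>, the pairs inside \<open>B\<close> and the pairs from
  the top vertex to one whole side are three disjoint families. Working with
  \<open>dominates\<close> avoids having to construct the search trees that a search tree on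
  \<open>J\<close> induces on \<open>A\<close> and \<open>B\<close>.\<close>

lemma pair_bound:
  assumes P: "dominates E J P"
    and A: "LA \<le> pair_weight A w P" and B: "LB \<le> pair_weight B w P"
  shows "WA + LA + LB \<le> pair_weight J w P"
proof -
  obtain r where r: "r \<in> J" "{r} \<times> J \<subseteq> P"
    using dominatesD[OF P _ _ connJ] by blast
  \<comment> \<open>The side of \<open>u\<close> that does not contain the top vertex \<open>r\<close> lies entirely below \<open>r\<close>.\<close>
  obtain X where X: "X \<subseteq> J" "r \<notin> A \<or> X \<inter> A = {}" "r \<notin> B \<or> X \<inter> B = {}" "sum w X = WA" "finite X"
  proof (cases "r \<in> A")
    case True
    then show ?thesis using that[of B] disj sumB fin by auto
  next
    case False
    then show ?thesis using that[of A] disj sumA fin by auto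
  qed
  let ?c = "\<lambda>V. P \<inter> V \<times> V"
  have finc: "finite (?c V)" if "finite V" for V using that by auto
  have "(\<Sum>(y, x)\<in>(?c A \<union> ?c B) \<union> {r} \<times> X. w x)
      = (\<Sum>(y, x)\<in>?c A \<union> ?c B. w x) + (\<Sum>(y, x)\<in>{r} \<times> X. w x)"
    using finc fin X disj by (intro sum.union_disjoint) auto
  also have "(\<Sum>(y, x)\<in>?c A \<union> ?c B. w x) = pair_weight A w P + pair_weight B w P"
    unfolding pair_weight_def using finc fin disj by (intro sum.union_disjoint) auto
  also have "(\<Sum>(y, x)\<in>{r} \<times> X. w x) = WA"
    using X by (simp add: sum.cartesian_product[symmetric])
  finally have "(\<Sum>(y, x)\<in>(?c A \<union> ?c B) \<union> {r} \<times> X. w x) \<ge> WA + LA + LB"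
    using A B by simp
  moreover have "(\<Sum>(y, x)\<in>(?c A \<union> ?c B) \<union> {r} \<times> X. w x) \<le> pair_weight J w P"
    unfolding pair_weight_def
    using r X finc[of J] fin w_nonneg by (intro sum_mono2) auto
  ultimately show ?thesis by linarith
qed

lemma search_tree_root_u:
  assumes "search_tree E A s" "search_tree E B t"
  obtains T where "search_tree E J T" "root T = u" "cost w T = w u + 2 * WA + cost w s + cost w t"
proof -
  have v: "verts s = A" "verts t = B" using assms verts_search_tree by auto
  have "A \<noteq> B" using disj ab by auto
  then have T: "search_tree E J (Node u [s, t])"
    using assms v comps_del_u by auto
  obtain s' t' where *: "search_tree E A s'" "search_tree E B t'" "set [s, t] = {s', t'}"
    "cost w (Node u [s, t]) = w u + 2 * WA + cost w s' + cost w t'"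
    using Node_u[OF T] by blast
  have "verts s' = A" "verts t' = B" using * verts_search_tree by auto
  then have "s' = s" "t' = t" using *(3) v \<open>A \<noteq> B\<close> by auto
  then show ?thesis using that[OF T] * by simp
qed

text \<open>The tree on \<open>B\<close> keeps its root \<open>b\<close>, and deleting
  \<open>b\<close> leaves \<open>insert u A\<close> as one further component. Its search tree is
  \<open>s\<close> with \<open>u\<close> hung in by the pendant construction, attached as a new
  child of \<open>b\<close>. Only \<open>s\<close> moves down a level, which costs
  \<open>WA\<close>; the depth of \<open>u\<close> is at most \<open>nA + 2\<close>.\<close>

lemma search_tree_root_b:
  assumes s: "search_tree E A s" and t: "search_tree E B t" "root t = b"
  obtains T where "search_tree E J T" "root T = b"
    "cost w T \<le> cost w t + cost w s + WA + w u * (real nA + 2)"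
proof -
  have J: "finite J" using fin by simp
  have sJ: "\<And>x y. x \<in> J \<Longrightarrow> y \<in> J \<Longrightarrow> E x y \<Longrightarrow> E y x" using symJ by blast
  obtain s' where s': "search_tree E (insert u A) s'"
    "cost_d w 2 s' \<le> cost_d w 2 s + w u * real (2 + card A)"
  proof -
    have "\<And>x. x \<in> A \<Longrightarrow> E x u = (x = a)" "\<And>x. x \<in> A \<Longrightarrow> E u x = (x = a)"
      using Eu ab by auto
    moreover have "0 \<le> w u" "\<And>x y. x \<in> A \<Longrightarrow> y \<in> A \<Longrightarrow> E x y \<Longrightarrow> E y x"
      using wu symA by auto
    ultimately show ?thesis
      using pendant_search_tree[OF s fin(1) uA ab(1), of w 2] that by blast
  qed
  obtain ts where ts: "t = Node b ts" using t(2) by (cases t) auto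
  let ?T = "Node b (s' # ts)"
  have v: "verts s' = insert u A" using s'(1) by (rule verts_search_tree)
  have cT: "distinct (map verts ts)" "set (map verts ts) = comps E (B - {b})"
    "\<And>t. t \<in> set ts \<Longrightarrow> search_tree E (verts t) t"
    using t ts by auto
  have "comps E (insert u A \<union> (B - {b})) = comps E (insert u A) \<union> comps E (B - {b})"
    using disj uB noAB Eu ab by (intro comps_Un) auto
  moreover have "insert u A \<union> (B - {b}) = J - {b}" using ab by auto
  moreover have "comps E (insert u A) = {insert u A}"
    using tree_join.conn_uB[OF swap] by (intro comps_conn) auto
  ultimately have "comps E (J - {b}) = insert (insert u A) (comps E (B - {b}))" by simp
  moreover have "insert u A \<notin> comps E (B - {b})"
    using Union_comps[of E "B - {b}"] uB by blast
  ultimately have "search_tree E J ?T"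
    using cT s'(1) v ab by auto
  moreover have "cost_d w (Suc 1) s = cost_d w 1 s + WA"
    using cost_d_Suc[OF J sJ s] sumA by auto
  then have "cost w ?T \<le> cost w t + cost w s + WA + w u * (real nA + 2)"
    using s'(2) wtA by (simp add: cost_def ts wtree_def numeral_2_eq_2 algebra_simps)
  ultimately show ?thesis using that[of ?T] root.simps by metis
qed

end

text \<open>The versions differ in the root used for the upper bound and in the vertex offered for
  the next join. The first roots and attaches at \<open>u\<close>, which creates a new centre. The
  second roots and attaches at \<open>b\<close>, which adds a copy to an existing centre. The third
  roots at \<open>b\<close> but attaches at the low-degree vertex \<open>u\<close>, which turns the
  result into a copy for the next round.\<close>

lemma gadget_joins:
  assumes A: "gadget D rA A E w a dA WA nA CA LA UA" and B: "gadget D rB B E w b dB WA nB CB LB UB"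
    and J: "tree_join D E w A B a b u dA dB nA nB WA"
  defines "J \<equiv> insert u (A \<union> B)" and "W \<equiv> w u + 2 * WA"
  shows "gadget D True J E w u 2 W (nA + nB + 1) (W + CA + CB) (WA + LA + LB) (W + UA + UB)" (is ?G1)
    and "rB \<Longrightarrow> gadget D True J E w b (Suc dB) W (nA + nB + 1) (W + CA + CB) (WA + LA + LB)
           (UB + UA + WA + w u * (real nA + 2))" (is "_ \<Longrightarrow> ?G2")
    and "rB \<Longrightarrow> gadget D False J E w u 2 W (nA + nB + 1) (W + CA + CB) (WA + LA + LB)
           (UB + UA + WA + w u * (real nA + 2))" (is "_ \<Longrightarrow> ?G3")
proof -
  interpret tree_join D E w A B a b u dA dB nA nB WA by (rule J)
  have cA: "\<And>T. centroid_tree A E w T \<Longrightarrow> cost w T = CA"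
    and cB: "\<And>T. centroid_tree B E w T \<Longrightarrow> cost w T = CB"
    and lA: "\<And>P. dominates E A P \<Longrightarrow> LA \<le> pair_weight A w P"
    and lB: "\<And>P. dominates E B P \<Longrightarrow> LB \<le> pair_weight B w P"
    using A B by (simp_all add: gadget_def)
  have c: "cost w T = W + CA + CB" if "centroid_tree J E w T" for T
    using centroid_cost[OF that[unfolded J_def] cA cB] unfolding W_def .
  have l: "WA + LA + LB \<le> pair_weight J w P" if "dominates E J P" for P
  proof -
    have "dominates E A P" "dominates E B P"
      using that dominates_mono[of E J P] unfolding J_def by auto
    then show ?thesis
      using pair_bound[OF that[unfolded J_def] lA lB] unfolding J_def by blast
  qed
  obtain s where s: "search_tree E A s" "cost w s \<le> UA"
    using A unfolding gadget_def by blast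
  obtain t where t: "search_tree E B t" "rB \<longrightarrow> root t = b" "cost w t \<le> UB"
    using B unfolding gadget_def by blast
  obtain T where T: "search_tree E J T" "root T = u" "cost w T = W + cost w s + cost w t"
    using search_tree_root_u[OF s(1) t(1)] unfolding J_def W_def by blast
  have wt: "wtree D J E w u 2 W (nA + nB + 1)" "wtree D J E w b (Suc dB) W (nA + nB + 1)"
    unfolding J_def W_def by (rule wtreeJ; simp)+
  show ?G1
    unfolding gadget_def using wt(1) c l T s t by fastforce
  assume rB
  then obtain T' where T': "search_tree E J T'" "root T' = b"
    "cost w T' \<le> cost w t + cost w s + WA + w u * (real nA + 2)"
    using search_tree_root_b[OF s(1) t(1)] t(2) unfolding J_def by blast
  then have "cost w T' \<le> UB + UA + WA + w u * (real nA + 2)" using s t by linarith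
  then show ?G2 ?G3
    unfolding gadget_def using wt c l T' by auto
qed

subsection \<open>Iterated joins\<close>

text \<open>The ancestor pairs of a search tree dominate \<open>V\<close> and their weight is its
  cost, so \<open>L\<close> bounds every search tree from below.\<close>

lemma gadget_bounds_OPT:
  assumes g: "gadget D rooted V E w a d W n C L U" and sup: "\<And>x y. E x y \<Longrightarrow> x \<in> V \<and> y \<in> V"
  shows "is_tree V E" "max_deg_le V E D" "\<forall>x\<in>V. w x \<ge> 0" "sum w V = W"
    "L \<le> OPT V E w" "OPT V E w \<le> U" "\<And>T. centroid_tree V E w T \<Longrightarrow> cost w T = C"
proof -
  have W: "wtree D V E w a d W n" using g by (simp add: gadget_def)
  then have fin: "finite V" and sym: "\<And>x y. x \<in> V \<Longrightarrow> y \<in> V \<Longrightarrow> E x y \<Longrightarrow> E y x \<and> x \<noteq> y"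
    unfolding wtree_def by blast+
  show "is_tree V E"
    unfolding is_tree_def using W sup sym unfolding wtree_def conn_def by blast
  show "max_deg_le V E D" "\<forall>x\<in>V. w x \<ge> 0" "sum w V = W"
    using W by (simp_all add: wtree_def)
  show "\<And>T. centroid_tree V E w T \<Longrightarrow> cost w T = C" using g by (simp add: gadget_def)
  have L: "L \<le> cost w T" if T: "search_tree E V T" for T
  proof -
    have "anc_pairs T \<inter> V \<times> V = anc_pairs T"
      using anc_pairs_subset[of T] verts_search_tree[OF T] by auto
    then have "cost w T = pair_weight V w (anc_pairs T)"
      using cost_d_pairs[OF fin _ T, of w 0] sym by (simp add: cost_def pair_weight_def)
    then show ?thesis using g dominates_anc_pairs[OF T] by (simp add: gadget_def)
  qed
  obtain T where T: "search_tree E V T" "cost w T \<le> U" using g unfolding gadget_def by blast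
  show "L \<le> OPT V E w"
    unfolding OPT_def using T L by (intro cInf_greatest) auto
  have "OPT V E w \<le> cost w T"
    unfolding OPT_def using T L by (intro cInf_lower bdd_belowI[of _ L]) auto
  then show "OPT V E w \<le> U" using T by simp
qed

lemma gadget_singleton: "gadget D True {v} (\<lambda>_ _. False) (\<lambda>_. W) v 0 W 1 W W W" if "0 < W"
proof -
  have t: "search_tree E {v} T = (T = Node v [])" for E and T :: "'a stree"
    by (cases T) auto
  have "W \<le> pair_weight {v} (\<lambda>_. W) P" if "dominates (\<lambda>_ _. False) {v} P" for P
  proof -
    have "(v, v) \<in> P" using dominatesD[OF that, of "{v}"] by auto
    then have "P \<inter> {v} \<times> {v} = {(v, v)}" by auto
    then show ?thesis by (simp add: pair_weight_def)
  qed
  then show ?thesis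
    using that by (auto simp: gadget_def wtree_def max_deg_le_def centroid_tree_def t cost_def)
qed

text \<open>The costs are measured per unit of total weight, so a copy can be scaled to any weight
  \<open>W\<close>. The bound \<open>N\<close> allows disjoint copies inside the natural numbers.
  The size \<open>n\<close> depends on neither, which keeps the depth of a connecting vertex under
  control.\<close>

definition avail :: "nat \<Rightarrow> bool \<Rightarrow> nat \<Rightarrow> nat \<Rightarrow> real \<Rightarrow> real \<Rightarrow> real \<Rightarrow> bool" where
  "avail D rooted d n c l u \<longleftrightarrow> (\<forall>W>0. \<forall>N. \<exists>(V :: nat set) E w a.
     V \<subseteq> {N..} \<and> gadget D rooted V E w a d W n (W * c) (W * l) (W * u))"

lemma availE:
  assumes "avail D rooted d n c l u" "0 < W"
  obtains V :: "nat set" and E w a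
  where "V \<subseteq> {N..}" "gadget D rooted V E w a d W n (W * c) (W * l) (W * u)"
proof -
  have "\<exists>(V :: nat set) E w a. V \<subseteq> {N..} \<and> gadget D rooted V E w a d W n (W * c) (W * l) (W * u)"
    using assms by (simp add: avail_def)
  then show ?thesis by (elim exE conjE) (rule that)
qed

lemma avail_singleton: "avail D True 0 1 1 1 1"
  unfolding avail_def
proof (intro allI impI)
  fix W :: real and N :: nat
  assume "0 < W"
  then have "gadget D True {N} (\<lambda>_ _. False) (\<lambda>_. W) N 0 W 1 (W * 1) (W * 1) (W * 1)"
    using gadget_singleton by simp
  moreover have "{N} \<subseteq> {N..}" by simp
  ultimately show "\<exists>V E w a. V \<subseteq> {N..} \<and> gadget D True V E w a 0 W 1 (W * 1) (W * 1) (W * 1)"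
    by blast
qed

text \<open>Here \<open>h\<close> is the fraction of the weight placed on the connecting vertex and
  \<open>q\<close> the fraction on each side, so \<open>h + 2 * q = 1\<close>.\<close>

lemma avail_joins:
  assumes A: "avail D rA dA nA cA lA uA" and B: "avail D rB dB nB cB lB uB"
    and d: "dA < D" "dB < D" "2 \<le> D" and h: "0 < h" "h < 1" and q: "q = (1 - h) / 2"
  shows "avail D True 2 (nA + nB + 1) (1 + q * (cA + cB)) (q + q * (lA + lB)) (1 + q * (uA + uB))"
    and "rB \<Longrightarrow> avail D True (Suc dB) (nA + nB + 1) (1 + q * (cA + cB)) (q + q * (lA + lB))
           (q + q * (uA + uB) + h * (real nA + 2))"
    and "rB \<Longrightarrow> avail D False 2 (nA + nB + 1) (1 + q * (cA + cB)) (q + q * (lA + lB))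
           (q + q * (uA + uB) + h * (real nA + 2))"
proof -
  define c where "c = 1 + q * (cA + cB)"
  define l where "l = q + q * (lA + lB)"
  define v where "v = q + q * (uA + uB) + h * (real nA + 2)"
  define v' where "v' = 1 + q * (uA + uB)"
  have "\<exists>(V :: nat set) E w u b. V \<subseteq> {N..} \<and>
     gadget D True V E w u 2 W (nA + nB + 1) (W * c) (W * l) (W * v') \<and>
     (rB \<longrightarrow> gadget D True V E w b (Suc dB) W (nA + nB + 1) (W * c) (W * l) (W * v) \<and>
       gadget D False V E w u 2 W (nA + nB + 1) (W * c) (W * l) (W * v))"
    if "0 < W" for W N
  proof -
    have qW: "0 < q * W" using h q that by simp
    \<comment> \<open>The number \<open>N\<close> itself becomes the connecting vertex. So
      \<open>A\<close> starts at \<open>Suc N\<close>, and \<open>B\<close> will start beyond both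
      \<open>N\<close> and \<open>Max A\<close>.\<close>
    obtain A :: "nat set" and EA wA a where a: "A \<subseteq> {Suc N..}"
      "gadget D rA A EA wA a dA (q * W) nA (q * W * cA) (q * W * lA) (q * W * uA)"
      by (rule availE[OF A qW])
    have wtA: "wtree D A EA wA a dA (q * W) nA" using a(2) by (simp add: gadget_def)
    then have "finite A" by (simp add: wtree_def)
    obtain B :: "nat set" and EB wB b where b: "B \<subseteq> {Suc (N + Max A)..}"
      "gadget D rB B EB wB b dB (q * W) nB (q * W * cB) (q * W * lB) (q * W * uB)"
      by (rule availE[OF B qW])
    have wtB: "wtree D B EB wB b dB (q * W) nB" using b(2) by (simp add: gadget_def)
    have ab: "a \<in> A" "b \<in> B" using wtA wtB by (simp_all add: wtree_def)
    have disj: "A \<inter> B = {}"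
    proof -
      have "x \<notin> B" if "x \<in> A" for x
        using Max_ge[OF \<open>finite A\<close> that] b(1) by fastforce
      then show ?thesis by blast
    qed
    have N: "N \<notin> A" "N \<notin> B" using a(1) b(1) by fastforce+
    define E where "E x y \<longleftrightarrow> x \<in> A \<and> y \<in> A \<and> EA x y \<or> x \<in> B \<and> y \<in> B \<and> EB x y
      \<or> x = N \<and> (y = a \<or> y = b) \<or> y = N \<and> (x = a \<or> x = b)" for x y
    define w where "w x = (if x \<in> A then wA x else if x \<in> B then wB x else h * W)" for x
    have gA: "gadget D rA A E w a dA (q * W) nA (q * W * cA) (q * W * lA) (q * W * uA)"
      by (rule gadget_cong[OF a(2)]) (use N disj in \<open>auto simp: E_def w_def\<close>)
    have gB: "gadget D rB B E w b dB (q * W) nB (q * W * cB) (q * W * lB) (q * W * uB)"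
      by (rule gadget_cong[OF b(2)]) (use N disj in \<open>auto simp: E_def w_def\<close>)
    have wN: "w N = h * W" using N by (simp add: w_def)
    have J: "tree_join D E w A B a b N dA dB nA nB (q * W)"
    proof
      show "wtree D A E w a dA (q * W) nA" "wtree D B E w b dB (q * W) nB"
        using gA gB by (simp_all add: gadget_def)
      show "0 < w N" using wN h that by simp
    qed (use disj N d ab in \<open>auto simp: E_def\<close>)
    have W: "w N + 2 * (q * W) = W" unfolding wN q by (simp add: field_simps)
    have vals: "W + q * W * cA + q * W * cB = W * c" "q * W + q * W * lA + q * W * lB = W * l"
      "W + q * W * uA + q * W * uB = W * v'"
      "q * W * uB + q * W * uA + q * W + w N * (real nA + 2) = W * v"
      unfolding c_def l_def v_def v'_def wN by (simp_all add: algebra_simps)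
    have "insert N (A \<union> B) \<subseteq> {N..}" using a(1) b(1) by fastforce
    then show ?thesis
      using gadget_joins[OF gA gB J] unfolding W vals by blast
  qed
  then show "avail D True 2 (nA + nB + 1) (1 + q * (cA + cB)) (q + q * (lA + lB)) (1 + q * (uA + uB))"
    and "rB \<Longrightarrow> avail D True (Suc dB) (nA + nB + 1) (1 + q * (cA + cB)) (q + q * (lA + lB))
           (q + q * (uA + uB) + h * (real nA + 2))"
    and "rB \<Longrightarrow> avail D False 2 (nA + nB + 1) (1 + q * (cA + cB)) (q + q * (lA + lB))
           (q + q * (uA + uB) + h * (real nA + 2))"
    unfolding avail_def c_def l_def v_def v'_def by meson+
qed

section \<open>Parameters in the limit of vanishing connecting weights\<close>

definition attains :: "nat \<Rightarrow> bool \<Rightarrow> nat \<Rightarrow> real \<Rightarrow> real \<Rightarrow> real \<Rightarrow> bool" where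
  "attains D rooted d C L U \<longleftrightarrow> (\<exists>n c l u. (\<forall>i::nat. avail D rooted d n (c i) (l i) (u i))
     \<and> c \<longlonglongrightarrow> C \<and> l \<longlonglongrightarrow> L \<and> u \<longlonglongrightarrow> U)"

lemma attainsI:
  assumes "\<And>i::nat. avail D rooted d n (c i) (l i) (u i)"
    and "c \<longlonglongrightarrow> C" "l \<longlonglongrightarrow> L" "u \<longlonglongrightarrow> U"
  shows "attains D rooted d C L U"
  using assms unfolding attains_def by metis

lemma attains_singleton: "attains D True 0 1 1 1"
  by (rule attainsI[OF avail_singleton tendsto_const tendsto_const tendsto_const])

lemma attains_weaken: "attains D rooted d C L U \<Longrightarrow> d \<le> d' \<Longrightarrow> attains D False d' C L U"
  unfolding attains_def avail_def by (meson gadget_weaken)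

text \<open>Along each sequence the size is fixed while the connecting fraction \<open>h i\<close>
  tends to 0. Hence \<open>q i\<close> tends to \<open>1 / 2\<close> and the error
  \<open>h i * (real nA + 2)\<close> vanishes.\<close>

lemma attains_joins:
  assumes A: "attains D rA dA CA LA UA" and B: "attains D rB dB CB LB UB"
    and d: "dA < D" "dB < D" "2 \<le> D"
  shows "attains D True 2 (1 + (CA + CB) / 2) (1 / 2 + (LA + LB) / 2) (1 + (UA + UB) / 2)"
    and "rB \<Longrightarrow> attains D True (Suc dB) (1 + (CA + CB) / 2) (1 / 2 + (LA + LB) / 2) (1 / 2 + (UA + UB) / 2)"
    and "rB \<Longrightarrow> attains D False 2 (1 + (CA + CB) / 2) (1 / 2 + (LA + LB) / 2) (1 / 2 + (UA + UB) / 2)"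
proof -
  obtain nA cA lA uA where a: "\<And>i. avail D rA dA nA (cA i) (lA i) (uA i)"
    "cA \<longlonglongrightarrow> CA" "lA \<longlonglongrightarrow> LA" "uA \<longlonglongrightarrow> UA"
    using A unfolding attains_def by blast
  obtain nB cB lB uB where b: "\<And>i. avail D rB dB nB (cB i) (lB i) (uB i)"
    "cB \<longlonglongrightarrow> CB" "lB \<longlonglongrightarrow> LB" "uB \<longlonglongrightarrow> UB"
    using B unfolding attains_def by blast
  \<comment> \<open>A null sequence starting at \<open>1 / 2\<close>, so that it stays strictly
    between 0 and 1.\<close>
  define h where "h i = inverse (real (Suc (Suc i)))" for i
  define q where "q i = (1 - h i) / 2" for i
  have h: "0 < h i" "h i < 1" for i by (simp_all add: h_def field_simps)
  have h0: "h \<longlonglongrightarrow> 0"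
    unfolding h_def using LIMSEQ_inverse_real_of_nat by (rule LIMSEQ_Suc)
  have q2: "q \<longlonglongrightarrow> 1 / 2"
    unfolding q_def using tendsto_divide[OF tendsto_diff[OF tendsto_const[of 1] h0] tendsto_const[of 2]] by simp
  {
    fix i
    note avail_joins[OF a(1)[of i] b(1)[of i] d h(1)[of i] h(2)[of i] q_def[of i]]
  }
  note J = this
  define c where "c i = 1 + q i * (cA i + cB i)" for i
  define l where "l i = q i + q i * (lA i + lB i)" for i
  define v where "v i = q i + q i * (uA i + uB i) + h i * (real nA + 2)" for i
  define v' where "v' i = 1 + q i * (uA i + uB i)" for i
  have "c \<longlonglongrightarrow> 1 + 1 / 2 * (CA + CB)" "l \<longlonglongrightarrow> 1 / 2 + 1 / 2 * (LA + LB)" 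
    "v \<longlonglongrightarrow> 1 / 2 + 1 / 2 * (UA + UB) + 0 * (real nA + 2)" "v' \<longlonglongrightarrow> 1 + 1 / 2 * (UA + UB)"
    unfolding c_def l_def v_def v'_def by (intro tendsto_intros h0 q2 a b)+
  then have lim: "c \<longlonglongrightarrow> 1 + (CA + CB) / 2" "l \<longlonglongrightarrow> 1 / 2 + (LA + LB) / 2" 
    "v \<longlonglongrightarrow> 1 / 2 + (UA + UB) / 2" "v' \<longlonglongrightarrow> 1 + (UA + UB) / 2"
    by simp_all
  show "attains D True 2 (1 + (CA + CB) / 2) (1 / 2 + (LA + LB) / 2) (1 + (UA + UB) / 2)"
    by (rule attainsI[OF _ lim(1,2,4)], unfold c_def l_def v'_def) (rule J(1))
  assume rB
  show "attains D True (Suc dB) (1 + (CA + CB) / 2) (1 / 2 + (LA + LB) / 2) (1 / 2 + (UA + UB) / 2)"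
    by (rule attainsI[OF _ lim(1,2,3)], unfold c_def l_def v_def) (rule J(2)[OF \<open>rB\<close>])
  show "attains D False 2 (1 + (CA + CB) / 2) (1 / 2 + (LA + LB) / 2) (1 / 2 + (UA + UB) / 2)"
    by (rule attainsI[OF _ lim(1,2,3)], unfold c_def l_def v_def) (rule J(3)[OF \<open>rB\<close>])
qed

text \<open>Joining a copy replaces \<open>x\<close> by \<open>1 + (C + x) / 2\<close> for the
  centroid cost, with fixed point \<open>2 + C\<close>, and by \<open>1 / 2 + (L + x) / 2\<close> or
  \<open>1 / 2 + (U + x) / 2\<close> for the bounds, with fixed points \<open>1 + L\<close> and
  \<open>1 + U\<close>. Each join halves the distance to the fixed point, and \<open>f\<close> is
  the value after \<open>m\<close> joins. The second conclusion takes the connecting vertex of the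
  last join as attachment, whence \<open>0 < m\<close>.\<close>

lemma attains_chain:
  assumes H: "attains D False 2 C L U" and R: "attains D True d X Y Z"
    and D: "3 \<le> D" "d + m \<le> D"
  defines "f \<equiv> \<lambda>x y. x + (y - x) / 2 ^ m"
  shows "attains D True (d + m) (f (2 + C) X) (f (1 + L) Y) (f (1 + U) Z)" (is ?T)
    and "0 < m \<Longrightarrow> attains D False 2 (f (2 + C) X) (f (1 + L) Y) (f (1 + U) Z)" (is "_ \<Longrightarrow> ?F")
proof -
  have "?T \<and> (0 < m \<longrightarrow> ?F)"
    using D(2) unfolding f_def
  proof (induction m)
    case 0
    then show ?case using R by simp
  next
    case (Suc m)
    have e: "1 + (C + (2 + C + (X - (2 + C)) / 2 ^ m)) / 2 = 2 + C + (X - (2 + C)) / 2 ^ Suc m"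
      "1 / 2 + (L + (1 + L + (Y - (1 + L)) / 2 ^ m)) / 2 = 1 + L + (Y - (1 + L)) / 2 ^ Suc m"
      "1 / 2 + (U + (1 + U + (Z - (1 + U)) / 2 ^ m)) / 2 = 1 + U + (Z - (1 + U)) / 2 ^ Suc m"
      by (simp_all add: field_simps)
    have B: "attains D True (d + m) (2 + C + (X - (2 + C)) / 2 ^ m)
        (1 + L + (Y - (1 + L)) / 2 ^ m) (1 + U + (Z - (1 + U)) / 2 ^ m)"
      using Suc by simp
    show ?case
      using attains_joins(2,3)[OF H B] D Suc.prems unfolding e by simp
  qed
  then show ?T "0 < m \<Longrightarrow> ?F" by auto
qed

section \<open>Recursions for the two kinds of centre\<close>

text \<open>The centre is a single vertex that keeps the fraction \<open>1 / 2 ^ D\<close> of the weight.\<close>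
lemma attains_single_centre:
  assumes "3 \<le> D"
  defines "r \<equiv> 1 - 1 / 2 ^ D"
  defines "L \<equiv> \<lambda>k. 2 ^ D - (2 ^ D - 1) * r ^ k"
  shows "attains D False 2 (2 * 2 ^ D - 1 - (2 * 2 ^ D - 2) * r ^ k) (L k) (L k)"
proof (induction k)
  case 0
  have "attains D False 2 1 1 1" using attains_weaken[OF attains_singleton] by simp
  then show ?case by (simp add: L_def)
next
  case (Suc k)
  \<comment> \<open>With \<open>p\<close> for \<open>2 ^ D\<close> and \<open>x\<close> for
    \<open>r ^ k\<close>: one round is an affine contraction with factor \<open>1 - 1 / p\<close>
    and fixed point \<open>2 * p - 1\<close> for the centroid cost, \<open>p\<close> for the
    optimum. Both quantities start at 1.\<close>
  have step: "2 + (2 * p - 1 - (2 * p - 2) * x) + (1 - (2 + (2 * p - 1 - (2 * p - 2) * x))) / p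
      = 2 * p - 1 - (2 * p - 2) * ((1 - 1 / p) * x)"
    "1 + (p - (p - 1) * x) + (1 - (1 + (p - (p - 1) * x))) / p = p - (p - 1) * ((1 - 1 / p) * x)"
    if "p \<noteq> 0" for p x :: real
    using that by (simp_all add: field_simps)
  have e1: "2 + (2 * 2 ^ D - 1 - (2 * 2 ^ D - 2) * r ^ k) + (1 - (2 + (2 * 2 ^ D - 1 - (2 * 2 ^ D - 2) * r ^ k))) / 2 ^ D
      = 2 * 2 ^ D - 1 - (2 * 2 ^ D - 2) * r ^ Suc k"
    using step(1)[of "2 ^ D" "r ^ k"] by (simp add: r_def)
  have e2: "1 + L k + (1 - (1 + L k)) / 2 ^ D = L (Suc k)"
    using step(2)[of "2 ^ D" "r ^ k"] by (simp add: L_def r_def)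
  \<comment> \<open>The single vertex starts with degree 0, so it can take \<open>D\<close>
    copies.\<close>
  have "0 + D \<le> D" "0 < D" using assms(1) by simp_all
  from attains_chain(2)[OF Suc attains_singleton assms(1) this] show ?case
    unfolding e1 e2 .
qed

text \<open>The centre joins two further copies of equal weight, hence has no weight in the limit.\<close>
lemma attains_light_centre:
  assumes "3 \<le> D"
  shows "\<exists>L \<ge> 1 + real k / 2. attains D False 2 (1 + real k * (2 - 4 / 2 ^ D)) L (1 + real k)"
proof (induction k)
  case 0
  have "attains D False 2 1 1 1" using attains_weaken[OF attains_singleton] by simp
  then show ?case by auto
next
  case (Suc k)
  let ?C = "1 + real k * (2 - 4 / 2 ^ D)" and ?U = "1 + real k"
  obtain L where L: "L \<ge> 1 + real k / 2" and H: "attains D False 2 ?C L ?U" using Suc by blast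
  \<comment> \<open>The connecting vertex serving as centre already has degree 2, which leaves
    \<open>D - 2\<close> further copies, at least one because \<open>3 \<le> D\<close>.\<close>
  obtain m where m: "D = m + 2" "0 < m"
  proof
    show "D = (D - 2) + 2" "0 < D - 2" using assms by auto
  qed
  \<comment> \<open>The upper bound \<open>1 + ?U\<close> of the centre is already the fixed point
    of the chain, so a round adds exactly 1 to it. The centroid cost \<open>1 + ?C\<close> lies 1
    below its fixed point \<open>2 + ?C\<close>, and \<open>m\<close> halvings turn this gap into
    \<open>1 / 2 ^ m = 4 / 2 ^ D\<close>.\<close>
  have R: "attains D True 2 (1 + (?C + ?C) / 2) (1 / 2 + (L + L) / 2) (1 + (?U + ?U) / 2)"
    using attains_joins(1)[OF H H] assms by simp
  let ?L = "1 + L + (1 / 2 + (L + L) / 2 - (1 + L)) / 2 ^ m"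
  have e1: "2 + ?C + (1 + (?C + ?C) / 2 - (2 + ?C)) / 2 ^ m = 1 + real (Suc k) * (2 - 4 / 2 ^ D)"
    by (simp add: m field_simps)
  have e2: "1 + ?U + (1 + (?U + ?U) / 2 - (1 + ?U)) / 2 ^ m = 1 + real (Suc k)"
    by (simp add: field_simps)
  have "2 + m \<le> D" using m by simp
  from attains_chain(2)[OF H R assms this m(2)]
  have "attains D False 2 (1 + real (Suc k) * (2 - 4 / 2 ^ D)) ?L (1 + real (Suc k))"
    unfolding e1 e2 .
  \<comment> \<open>The centre starts \<open>1 / 2\<close> below the fixed point
    \<open>1 + L\<close>, so a round gains at least \<open>1 / 2\<close>. This crude rate is enough
    to make the optimum unbounded.\<close>
  moreover have "?L \<ge> 1 + real (Suc k) / 2"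
  proof -
    define x :: real where "x = 1 / (2 * 2 ^ m)"
    have "x \<le> 1 / 2" by (simp add: x_def field_simps)
    moreover have "?L = 1 + L - x" by (simp add: x_def field_simps)
    ultimately show ?thesis using L by simp
  qed
  ultimately show ?case by blast
qed

section \<open>Extraction of the instance sequences\<close>

text \<open>Restricting \<open>E\<close> to \<open>V\<close> meets the support condition of \<open>is_tree\<close>.\<close>
lemma avail_instance:
  assumes "avail D rooted d n c l u"
  obtains V :: "nat set" and E w
  where "is_tree V E" "max_deg_le V E D" "\<forall>x\<in>V. w x \<ge> 0" "sum w V = 1"
    "l \<le> OPT V E w" "OPT V E w \<le> u" "\<forall>T. centroid_tree V E w T \<longrightarrow> cost w T = c"
proof -
  obtain V :: "nat set" and E w a where "gadget D rooted V E w a d 1 n (1 * c) (1 * l) (1 * u)"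
    by (rule availE[OF assms zero_less_one, where N = 0])
  then have g: "gadget D rooted V E w a d 1 n c l u" by simp
  have "gadget D rooted V (\<lambda>x y. x \<in> V \<and> y \<in> V \<and> E x y) w a d 1 n c l u"
    by (rule gadget_cong[OF g]) auto
  from gadget_bounds_OPT[OF this] show ?thesis
    by (intro that[of V "\<lambda>x y. x \<in> V \<and> y \<in> V \<and> E x y" w]) blast+
qed

lemma attains_near:
  assumes "attains D rooted d C L U" "0 < e"
  obtains n c l u where "avail D rooted d n c l u" "\<bar>c - C\<bar> < e" "\<bar>l - L\<bar> < e" "\<bar>u - U\<bar> < e"
proof -
  obtain n c l u where a: "\<And>i. avail D rooted d n (c i) (l i) (u i)"
    and lim: "c \<longlonglongrightarrow> C" "l \<longlonglongrightarrow> L" "u \<longlonglongrightarrow> U"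
    using assms(1) unfolding attains_def by blast
  have "\<forall>\<^sub>F i in sequentially. \<bar>c i - C\<bar> < e \<and> \<bar>l i - L\<bar> < e \<and> \<bar>u i - U\<bar> < e"
    using tendstoD[OF lim(1) assms(2)] tendstoD[OF lim(2) assms(2)] tendstoD[OF lim(3) assms(2)]
    by eventually_elim (simp add: dist_real_def)
  then obtain i where "\<bar>c i - C\<bar> < e \<and> \<bar>l i - L\<bar> < e \<and> \<bar>u i - U\<bar> < e"
    by (auto simp: eventually_sequentially)
  then show ?thesis using that a by blast
qed

text \<open>The values after \<open>n\<close> rounds are themselves only limits, so the
  \<open>n\<close>-th instance is chosen within \<open>1 / (n + 1)\<close> of them. As
  \<open>r ^ n\<close> vanishes, the centroid cost tends to \<open>2 * 2 ^ D - 1\<close> and the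
  optimum to \<open>2 ^ D\<close>.\<close>

lemma centroid_ratio_limit:
  assumes "3 \<le> D"
  shows "\<exists>(V :: nat \<Rightarrow> nat set) (E :: nat \<Rightarrow> nat \<Rightarrow> nat \<Rightarrow> bool) (w :: nat \<Rightarrow> nat \<Rightarrow> real).
            (\<forall>n. is_tree (V n) (E n) \<and> max_deg_le (V n) (E n) D \<and> (\<forall>x\<in>V n. w n x \<ge> 0))
          \<and> (\<forall>C :: nat \<Rightarrow> nat stree. (\<forall>n. centroid_tree (V n) (E n) (w n) (C n)) \<longrightarrow>
               (\<lambda>n. cost (w n) (C n) / OPT (V n) (E n) (w n)) \<longlonglongrightarrow> 2 - 1 / 2 ^ D)"
proof -
  define r :: real where "r = 1 - 1 / 2 ^ D"
  define L where "L n = 2 ^ D - (2 ^ D - 1) * r ^ n" for n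
  define C where "C n = 2 * 2 ^ D - 1 - (2 * 2 ^ D - 2) * r ^ n" for n
  define e where "e n = inverse (real (Suc n))" for n
  define P where "P n V E w c \<longleftrightarrow> is_tree V E \<and> max_deg_le V E D \<and> (\<forall>x\<in>V. w x \<ge> 0)
      \<and> \<bar>OPT V E w - L n\<bar> < e n \<and> (\<forall>T. centroid_tree V E w T \<longrightarrow> cost w T = c) \<and> \<bar>c - C n\<bar> < e n"
    for n c and V :: "nat set" and E w
  have "\<exists>V E w c. P n V E w c" for n
  proof -
    have "0 < e n" by (simp add: e_def)
    then obtain m c l u where a: "avail D False 2 m c l u"
      and near: "\<bar>c - C n\<bar> < e n" "\<bar>l - L n\<bar> < e n" "\<bar>u - L n\<bar> < e n"
      using attains_near[OF attains_single_centre[OF assms, of n]] unfolding C_def L_def r_def by blast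
    obtain V :: "nat set" and E w where V: "is_tree V E" "max_deg_le V E D" "\<forall>x\<in>V. w x \<ge> 0"
      "l \<le> OPT V E w" "OPT V E w \<le> u" "\<forall>T. centroid_tree V E w T \<longrightarrow> cost w T = c"
      by (rule avail_instance[OF a])
    have "\<bar>OPT V E w - L n\<bar> < e n" using near V(4,5) by linarith
    then show ?thesis using V near unfolding P_def by blast
  qed
  then have "\<forall>n. \<exists>V E w c. P n V E w c" by (rule allI)
  then obtain V E w c where "\<forall>n. P n (V n) (E n) (w n) (c n)" unfolding choice_iff by (elim exE)
  note P = this[unfolded P_def, rule_format]
  have r: "(\<lambda>n. r ^ n) \<longlonglongrightarrow> 0"
  proof (rule LIMSEQ_realpow_zero)
    show "0 \<le> r" "r < 1" by (simp_all add: r_def)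
  qed
  have e: "e \<longlonglongrightarrow> 0"
    unfolding e_def by (rule LIMSEQ_inverse_real_of_nat)
  have near: "f \<longlonglongrightarrow> a" if "\<And>n. \<bar>f n - g n\<bar> < e n" "g \<longlonglongrightarrow> a" for f g :: "nat \<Rightarrow> real" and a
  proof -
    have "(\<lambda>n. f n - g n) \<longlonglongrightarrow> 0"
    proof (rule tendsto_0_le[OF e, where K = 1], intro always_eventually allI)
      show "norm (f n - g n) \<le> norm (e n) * 1" for n
        using that(1)[of n] by simp
    qed
    from tendsto_add[OF this that(2)] show ?thesis by simp
  qed
  have "C \<longlonglongrightarrow> 2 * 2 ^ D - 1 - (2 * 2 ^ D - 2) * 0" "L \<longlonglongrightarrow> 2 ^ D - (2 ^ D - 1) * 0"
    unfolding C_def L_def by (intro tendsto_intros r)+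
  then have "c \<longlonglongrightarrow> 2 * 2 ^ D - 1 - (2 * 2 ^ D - 2) * 0"
    "(\<lambda>n. OPT (V n) (E n) (w n)) \<longlonglongrightarrow> 2 ^ D - (2 ^ D - 1) * 0"
    using P by (auto intro: near)
  then have "(\<lambda>n. c n / OPT (V n) (E n) (w n)) \<longlonglongrightarrow> (2 * 2 ^ D - 1) / 2 ^ D"
    by (intro tendsto_divide) auto
  also have "(2 * 2 ^ D - 1) / 2 ^ D = 2 - 1 / (2 :: real) ^ D"
    by (simp add: field_simps)
  finally have lim: "(\<lambda>n. c n / OPT (V n) (E n) (w n)) \<longlonglongrightarrow> 2 - 1 / 2 ^ D" .
  have "(\<lambda>n. cost (w n) (T n) / OPT (V n) (E n) (w n)) \<longlonglongrightarrow> 2 - 1 / 2 ^ D"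
    if "\<forall>n. centroid_tree (V n) (E n) (w n) (T n)" for T
  proof -
    have "cost (w n) (T n) = c n" for n using P that by blast
    then show ?thesis using lim by simp
  qed
  then show ?thesis using P by blast
qed

lemma centroid_ratio_large_OPT:
  assumes "3 \<le> D"
  shows "\<exists>(V :: nat \<Rightarrow> nat set) (E :: nat \<Rightarrow> nat \<Rightarrow> nat \<Rightarrow> bool) (w :: nat \<Rightarrow> nat \<Rightarrow> real).
            (\<forall>n. is_tree (V n) (E n) \<and> max_deg_le (V n) (E n) D \<and> (\<forall>x\<in>V n. w n x \<ge> 0)
                 \<and> sum (w n) (V n) = 1)
          \<and> filterlim (\<lambda>n. OPT (V n) (E n) (w n)) at_top sequentially
          \<and> (\<forall>n T. centroid_tree (V n) (E n) (w n) T \<longrightarrow>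
               cost (w n) T \<ge> (2 - 4 / 2 ^ D) * OPT (V n) (E n) (w n) - 1)"
proof -
  define al :: real where "al = 2 - 4 / 2 ^ D"
  \<comment> \<open>This is also the tolerance for the approximation. Since
    \<open>al - 1 = 1 - 4 * e\<close>, the permitted loss of 1 leaves slack \<open>4 * e\<close>,
    which covers the error \<open>al * e \<le> 2 * e\<close> from the optimum and the error
    \<open>e\<close> from the centroid cost.\<close>
  define e :: real where "e = 1 / 2 ^ D"
  have "(2::real) ^ 3 \<le> 2 ^ D" using assms by (intro power_increasing) auto
  then have e: "0 < e" "e \<le> 1 / 8" and al: "al = 2 - 4 * e"
    unfolding e_def al_def by (simp_all add: field_simps)
  define P where "P k V E w \<longleftrightarrow> is_tree V E \<and> max_deg_le V E D \<and> (\<forall>x\<in>V. w x \<ge> 0) \<and> sum w V = 1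
      \<and> real k / 2 \<le> OPT V E w \<and> (\<forall>T. centroid_tree V E w T \<longrightarrow> cost w T \<ge> al * OPT V E w - 1)"
    for k and V :: "nat set" and E w
  have "\<exists>V E w. P k V E w" for k
  proof -
    obtain L where L: "L \<ge> 1 + real k / 2" and at: "attains D False 2 (1 + real k * al) L (1 + real k)"
      using attains_light_centre[OF assms, of k] unfolding al_def by blast
    obtain n c l u where a: "avail D False 2 n c l u"
      and near: "\<bar>c - (1 + real k * al)\<bar> < e" "\<bar>l - L\<bar> < e" "\<bar>u - (1 + real k)\<bar> < e"
      using attains_near[OF at e(1)] by blast
    obtain V :: "nat set" and E w where V: "is_tree V E" "max_deg_le V E D" "\<forall>x\<in>V. w x \<ge> 0"
      "sum w V = 1" "l \<le> OPT V E w" "OPT V E w \<le> u" "\<forall>T. centroid_tree V E w T \<longrightarrow> cost w T = c"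
      by (rule avail_instance[OF a])
    have "al * OPT V E w \<le> al * (1 + real k + e)"
      using near V(6) e al by (intro mult_left_mono) auto
    also have "\<dots> = 1 + real k * al + (al - 1) + al * e" by (simp add: algebra_simps)
    also have "\<dots> \<le> 1 + real k * al - e + 1"
    proof -
      have "al * e \<le> 2 * e" using e al by (intro mult_right_mono) auto
      then show ?thesis using al e by simp
    qed
    also have "\<dots> \<le> c + 1" using near by linarith
    finally have "al * OPT V E w - 1 \<le> c" by simp
    moreover have "real k / 2 \<le> OPT V E w" using L near(2) e V(5) by linarith
    ultimately show ?thesis using V unfolding P_def by blast
  qed
  then have "\<forall>k. \<exists>V E w. P k V E w" by (rule allI)
  then obtain V E w where "\<forall>k. P k (V k) (E k) (w k)" unfolding choice_iff by (elim exE)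
  note P = this[unfolded P_def, rule_format]
  have "filterlim (\<lambda>k. real k / 2) at_top sequentially"
    using filterlim_tendsto_pos_mult_at_top[OF tendsto_const[of "1 / 2"] _ filterlim_real_sequentially]
    by (simp add: field_simps)
  then have "filterlim (\<lambda>k. OPT (V k) (E k) (w k)) at_top sequentially"
    by (rule filterlim_at_top_mono) (use P in auto)
  then show ?thesis using P unfolding al_def by blast
qed

theorem theorem5:
  fixes \<Delta> :: nat
  assumes "\<Delta> \<ge> 3"
  shows "(\<exists>(V :: nat \<Rightarrow> nat set) (E :: nat \<Rightarrow> nat \<Rightarrow> nat \<Rightarrow> bool) (w :: nat \<Rightarrow> nat \<Rightarrow> real).
            (\<forall>n. is_tree (V n) (E n) \<and> max_deg_le (V n) (E n) \<Delta> \<and> (\<forall>x\<in>V n. w n x \<ge> 0))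
          \<and> (\<forall>C :: nat \<Rightarrow> nat stree. (\<forall>n. centroid_tree (V n) (E n) (w n) (C n)) \<longrightarrow>
               (\<lambda>n. cost (w n) (C n) / OPT (V n) (E n) (w n)) \<longlonglongrightarrow> 2 - 1 / 2 ^ \<Delta>))
       \<and> (\<exists>(V :: nat \<Rightarrow> nat set) (E :: nat \<Rightarrow> nat \<Rightarrow> nat \<Rightarrow> bool) (w :: nat \<Rightarrow> nat \<Rightarrow> real).
            (\<forall>n. is_tree (V n) (E n) \<and> max_deg_le (V n) (E n) \<Delta> \<and> (\<forall>x\<in>V n. w n x \<ge> 0)
                 \<and> sum (w n) (V n) = 1)
          \<and> filterlim (\<lambda>n. OPT (V n) (E n) (w n)) at_top sequentially
          \<and> (\<forall>n T. centroid_tree (V n) (E n) (w n) T \<longrightarrow>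
               cost (w n) T \<ge> (2 - 4 / 2 ^ \<Delta>) * OPT (V n) (E n) (w n) - 1))"
  using centroid_ratio_limit[OF assms] centroid_ratio_large_OPT[OF assms] by (rule conjI)

end
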